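(* Let $(\mathbb M,g)$ be a complete, connected, smooth, $n$-dimensional Riemannian manifold without boundary, let $H_i\in C^1(\mathbb R^m)$ for $1\le i\le m$, and let $u=(u_i)_{i=1}^m$, $u_i\in C^3(\mathbb M)$, be a stable solution of $$-\Delta_g u_i = H_i(u_1,\dots,u_m)\quad\text{on } \mathbb M,\qquad i=1,\dots,m.$$ Then $$\sum_{i,j=1}^{m} \int_{\mathbb M} \sqrt{\partial_j H_i(u)\, \partial_i H_j(u)}\; \phi_i \phi_j \, dV_g\le \sum_{i=1}^{m} \int_{\mathbb M} |\nabla_g \phi_i|^2 \, dV_g$$ for any $\phi=(\phi_i)_{i=1}^m$ with $\phi_i\in C_c^1(\mathbb M)$ for $1\le i\le m$.
   Context: Notation: $\Delta_g$ is the Laplace-Beltrami operator, $\nabla_g$ the Riemannian gradient, $dV_g$ the Riemannian volume element, and $\partial_j H_i(u)=\frac{\partial H_i}{\partial u_j}(u)$, where $u$ denotes the solution evaluated at points of $\mathbb M$. Standing assumption: $\partial_i H_j(u)\,\partial_j H_i(u)>0$ for all $1\le i,j\le m$. Definition (stable solution): a solution $u=(u_i)_{i=1}^m$ of the system is stable if there exist functions $\zeta=(\zeta_i)_{i=1}^m$, where each $\zeta_i\in C^3(\mathbb M)$ does not change sign, and a nonnegative constant $\lambda$ such that $$-\Delta_g \zeta_i=\sum_{j=1}^m \partial_jH_i(u)\,\zeta_j+\lambda\zeta_i\quad\text{on }\mathbb M,\qquad i=1,\dots,m,$$ and moreover $\partial_jH_i(u)\,\zeta_i\zeta_j>0$ for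 all $1\le i,j\le m$. *)

theory Defs
  imports "HOL-Analysis.Analysis"
begin

section \<open>Functions of class $C^k$ on open subsets of normed spaces\<close>

text \<open>The second argument is always an open set here.\<close>

primrec Ck_on :: "nat \<Rightarrow> 'e set \<Rightarrow> ('e::real_normed_vector \<Rightarrow> 'f::real_normed_vector) \<Rightarrow> bool" where
  "Ck_on 0 S f \<longleftrightarrow> continuous_on S f"
| "Ck_on (Suc k) S f \<longleftrightarrow>
     (\<forall>x\<in>S. f differentiable (at x)) \<and>
     (\<forall>v. Ck_on k S (\<lambda>x. frechet_derivative f (at x) v))"

definition smooth_on :: "'e set \<Rightarrow> ('e::real_normed_vector \<Rightarrow> 'f::real_normed_vector) \<Rightarrow> bool" where
  "smooth_on S f \<longleftrightarrow> (\<forall>k. Ck_on k S f)"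

definition partial :: "'k \<Rightarrow> (real ^ 'k \<Rightarrow> real) \<Rightarrow> real ^ 'k \<Rightarrow> real" where
  "partial i f x = frechet_derivative f (at x) (axis i 1)"


section \<open>Smooth manifolds\<close>

text \<open>
  The points of the manifold are all elements of a Hausdorff, second countable type \<open>'a\<close>.
  The smooth structure is given by an atlas, which need not be maximal, of charts with values in
  open subsets of \<open>real ^ 'n\<close>; in particular there is no boundary, and the dimension is
  \<open>CARD('n)\<close>. A chart is a pair of its domain and its coordinate map; the values of the
  coordinate map outside the domain are irrelevant.
\<close>

type_synonym ('a, 'n) chart = "'a set \<times> ('a \<Rightarrow> real ^ 'n)"

definition coord_dom :: "('a, 'n) chart \<Rightarrow> (real ^ 'n) set" where
  "coord_dom c = snd c ` fst c"

definition chart_inv :: "('a, 'n) chart \<Rightarrow> real ^ 'n \<Rightarrow> 'a" where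
  "chart_inv c = inv_into (fst c) (snd c)"

definition is_chart :: "('a::topological_space, 'n::finite) chart \<Rightarrow> bool" where
  "is_chart c \<longleftrightarrow> open (fst c) \<and> open (coord_dom c) \<and>
     homeomorphism (fst c) (coord_dom c) (snd c) (chart_inv c)"

definition transition :: "('a, 'n) chart \<Rightarrow> ('a, 'n) chart \<Rightarrow> real ^ 'n \<Rightarrow> real ^ 'n" where
  "transition c d = snd d \<circ> chart_inv c"

definition smooth_atlas ::
  "('a::{t2_space, second_countable_topology}, 'n::finite) chart set \<Rightarrow> bool" where
  "smooth_atlas A \<longleftrightarrow>
     (\<forall>c\<in>A. is_chart c) \<and>
     (\<Union>c\<in>A. fst c) = UNIV \<and>
     (\<forall>c\<in>A. \<forall>d\<in>A. smooth_on (snd c ` (fst c \<inter> fst d)) (transition c d))"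

definition Ck_manifold ::
  "('a, 'n::finite) chart set \<Rightarrow> nat \<Rightarrow> ('a \<Rightarrow> real) \<Rightarrow> bool" where
  "Ck_manifold A k f \<longleftrightarrow> (\<forall>c\<in>A. Ck_on k (coord_dom c) (f \<circ> chart_inv c))"

definition Ckc_manifold ::
  "('a::topological_space, 'n::finite) chart set \<Rightarrow> nat \<Rightarrow> ('a \<Rightarrow> real) \<Rightarrow> bool" where
  "Ckc_manifold A k f \<longleftrightarrow> Ck_manifold A k f \<and> compact (closure {p. f p \<noteq> 0})"

text \<open>
  An arbitrary chart around a point. The pointwise notions below are computed in this chart;
  by the transformation law of the metric, they do not depend on the choice.
\<close>

definition chart_at :: "('a, 'n) chart set \<Rightarrow> 'a \<Rightarrow> ('a, 'n) chart" where
  "chart_at A p = (SOME c. c \<in> A \<and> p \<in> fst c)"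


section \<open>Riemannian metrics\<close>

text \<open>
  A metric is given by its coordinate matrices: \<open>g c x\<close> is the matrix $(g_{ij})$ in the chart
  \<open>c\<close> at the point with coordinates \<open>x\<close>. The last condition is the transformation law of
  a covariant 2-tensor.
\<close>

type_synonym ('a, 'n) metric_field = "('a, 'n) chart \<Rightarrow> real ^ 'n \<Rightarrow> real ^ 'n ^ 'n"

definition riemannian_metric ::
  "('a, 'n::finite) chart set \<Rightarrow> ('a, 'n) metric_field \<Rightarrow> bool" where
  "riemannian_metric A g \<longleftrightarrow>
     (\<forall>c\<in>A. smooth_on (coord_dom c) (g c)) \<and>
     (\<forall>c\<in>A. \<forall>x\<in>coord_dom c.
        transpose (g c x) = g c x \<and> (\<forall>v. v \<noteq> 0 \<longrightarrow> v \<bullet> (g c x *v v) > 0)) \<and>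
     (\<forall>c\<in>A. \<forall>d\<in>A. \<forall>x\<in>snd c ` (fst c \<inter> fst d).
        let D = jacobian (transition c d) (at x)
        in g c x = transpose D ** g d (transition c d x) ** D)"

text \<open>The norm of the tangent vector with components \<open>v\<close> in the chart \<open>c\<close>.\<close>

definition metric_norm ::
  "('a, 'n::finite) metric_field \<Rightarrow> ('a, 'n) chart \<Rightarrow> real ^ 'n \<Rightarrow> real ^ 'n \<Rightarrow> real" where
  "metric_norm g c x v = sqrt (v \<bullet> (g c x *v v))"


subsection \<open>Distance and completeness\<close>

definition piecewise_C1_curve ::
  "('a::topological_space, 'n::finite) chart set \<Rightarrow> (real \<Rightarrow> 'a) \<Rightarrow> bool" where
  "piecewise_C1_curve A \<gamma> \<longleftrightarrow> path \<gamma> \<and>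
     (\<forall>c\<in>A. \<forall>a b. 0 \<le> a \<and> a \<le> b \<and> b \<le> 1 \<and> \<gamma> ` {a..b} \<subseteq> fst c \<longrightarrow>
        (snd c \<circ> \<gamma>) piecewise_C1_differentiable_on {a..b})"

text \<open>
  The speed has no meaning at the finitely many break points of the curve, which do not
  contribute to the length.
\<close>

definition curve_speed ::
  "('a, 'n::finite) chart set \<Rightarrow> ('a, 'n) metric_field \<Rightarrow> (real \<Rightarrow> 'a) \<Rightarrow> real \<Rightarrow> real" where
  "curve_speed A g \<gamma> t =
     (let c = chart_at A (\<gamma> t)
      in metric_norm g c (snd c (\<gamma> t)) (vector_derivative (snd c \<circ> \<gamma>) (at t)))"

definition curve_length ::
  "('a, 'n::finite) chart set \<Rightarrow> ('a, 'n) metric_field \<Rightarrow> (real \<Rightarrow> 'a) \<Rightarrow> ennreal" where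
  "curve_length A g \<gamma> = (\<integral>\<^sup>+ t\<in>{0..1}. ennreal (curve_speed A g \<gamma> t) \<partial>lborel)"

definition riemannian_dist ::
  "('a::topological_space, 'n::finite) chart set \<Rightarrow> ('a, 'n) metric_field \<Rightarrow> 'a \<Rightarrow> 'a \<Rightarrow> real" where
  "riemannian_dist A g p q = enn2real
     (INF \<gamma>\<in>{\<gamma>. piecewise_C1_curve A \<gamma> \<and> pathstart \<gamma> = p \<and> pathfinish \<gamma> = q}.
        curve_length A g \<gamma>)"

text \<open>
  Only meaningful on a connected manifold, where any two points are joined by a piecewise $C^1$
  curve of finite length.
\<close>

definition complete_riemannian ::
  "('a::topological_space, 'n::finite) chart set \<Rightarrow> ('a, 'n) metric_field \<Rightarrow> bool" where
  "complete_riemannian A g \<longleftrightarrow> Metric_space.mcomplete UNIV (riemannian_dist A g)"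


subsection \<open>Volume, gradient, Laplace--Beltrami operator\<close>

text \<open>The Borel measure that is $\sqrt{\det g}\,dx$ in every chart.\<close>

definition riemannian_volume ::
  "('a::topological_space, 'n::finite) chart set \<Rightarrow> ('a, 'n) metric_field \<Rightarrow> 'a measure" where
  "riemannian_volume A g = (THE V. sets V = sets borel \<and>
     (\<forall>c\<in>A. \<forall>B\<in>sets borel. B \<subseteq> fst c \<longrightarrow>
        emeasure V B = (\<integral>\<^sup>+ x\<in>snd c ` B. ennreal (sqrt (det (g c x))) \<partial>lborel)))"

text \<open>Components $g^{ij}\,\partial_j f$ of the gradient in the chart \<open>c\<close>.\<close>

definition grad_chart ::
  "('a, 'n::finite) metric_field \<Rightarrow> ('a, 'n) chart \<Rightarrow> ('a \<Rightarrow> real) \<Rightarrow> real ^ 'n \<Rightarrow> real ^ 'n" where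
  "grad_chart g c f x = matrix_inv (g c x) *v (\<chi> j. partial j (f \<circ> chart_inv c) x)"

text \<open>$(\det g)^{-1/2}\, \partial_i (\sqrt{\det g}\, X^i)$\<close>

definition div_chart ::
  "('a, 'n::finite) metric_field \<Rightarrow> ('a, 'n) chart \<Rightarrow> (real ^ 'n \<Rightarrow> real ^ 'n) \<Rightarrow> real ^ 'n \<Rightarrow> real"
  where
  "div_chart g c X x =
     (\<Sum>i\<in>UNIV. partial i (\<lambda>y. sqrt (det (g c y)) * X y $ i) x) / sqrt (det (g c x))"

definition grad_norm ::
  "('a, 'n::finite) chart set \<Rightarrow> ('a, 'n) metric_field \<Rightarrow> ('a \<Rightarrow> real) \<Rightarrow> 'a \<Rightarrow> real" where
  "grad_norm A g f p =
     (let c = chart_at A p; x = snd c p in metric_norm g c x (grad_chart g c f x))"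

definition laplace_beltrami ::
  "('a, 'n::finite) chart set \<Rightarrow> ('a, 'n) metric_field \<Rightarrow> ('a \<Rightarrow> real) \<Rightarrow> 'a \<Rightarrow> real" where
  "laplace_beltrami A g f p =
     (let c = chart_at A p in div_chart g c (grad_chart g c f) (snd c p))"


section \<open>The elliptic system\<close>

definition is_solution ::
  "('a, 'n::finite) chart set \<Rightarrow> ('a, 'n) metric_field \<Rightarrow>
   ('m::finite \<Rightarrow> real ^ 'm \<Rightarrow> real) \<Rightarrow> ('m \<Rightarrow> 'a \<Rightarrow> real) \<Rightarrow> bool" where
  "is_solution A g H u \<longleftrightarrow>
     (\<forall>i. Ck_manifold A 3 (u i)) \<and>
     (\<forall>i p. - laplace_beltrami A g (u i) p = H i (\<chi> k. u k p))"

text \<open>The function $\partial_j H_i(u)$ on the manifold.\<close>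

definition dH ::
  "('m::finite \<Rightarrow> real ^ 'm \<Rightarrow> real) \<Rightarrow> ('m \<Rightarrow> 'a \<Rightarrow> real) \<Rightarrow> 'm \<Rightarrow> 'm \<Rightarrow> 'a \<Rightarrow> real" where
  "dH H u j i p = partial j (H i) (\<chi> k. u k p)"

definition stable_solution ::
  "('a, 'n::finite) chart set \<Rightarrow> ('a, 'n) metric_field \<Rightarrow>
   ('m::finite \<Rightarrow> real ^ 'm \<Rightarrow> real) \<Rightarrow> ('m \<Rightarrow> 'a \<Rightarrow> real) \<Rightarrow> bool" where
  "stable_solution A g H u \<longleftrightarrow> is_solution A g H u \<and>
     (\<exists>(\<zeta> :: 'm \<Rightarrow> 'a \<Rightarrow> real) (lam :: real).
        (\<forall>i. Ck_manifold A 3 (\<zeta> i)) \<and>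
        (\<forall>i. (\<forall>p. \<zeta> i p \<ge> 0) \<or> (\<forall>p. \<zeta> i p \<le> 0)) \<and>
        lam \<ge> 0 \<and>
        (\<forall>i p. - laplace_beltrami A g (\<zeta> i) p =
            (\<Sum>j\<in>UNIV. dH H u j i p * \<zeta> j p) + lam * \<zeta> i p) \<and>
        (\<forall>i j p. dH H u j i p * \<zeta> i p * \<zeta> j p > 0))"

end

theory Submission imports Defs begin

text \<open>
Stability yields functions \<open>\<zeta> i\<close>, none of which vanishes, that satisfy the linearised system up to
the term \<open>lam * \<zeta> i\<close>, whose contribution has a favourable sign since \<open>lam \<ge> 0\<close>. The inequality
comes from testing the \<open>i\<close>-th equation with
\<open>\<psi> i = \<phi> i * \<phi> i / \<zeta> i\<close>, a compactly supported $C^1$ function. On the side of the potential, the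
condition $\partial_j H_i(u)\,\zeta_i\zeta_j > 0$ makes all
$b_{ij} = \partial_j H_i(u)\,\zeta_j/\zeta_i$ positive, and the arithmetic-geometric mean inequality
$b_{ij}\phi_i^2 + b_{ji}\phi_j^2 \ge 2\sqrt{b_{ij}b_{ji}}\,|\phi_i\phi_j|$ does the rest, since
$b_{ij}b_{ji} = \partial_j H_i(u)\,\partial_i H_j(u)$ (\<open>stability_pointwise\<close>). On the side of the
Laplacian, Green's formula turns $-\int \psi_i\,\Delta_g\zeta_i$ into
$\int \langle\nabla\psi_i,\nabla\zeta_i\rangle$, and the integrand is at most $|\nabla\phi_i|^2$ because the
difference is the square $|\nabla\phi_i - (\phi_i/\zeta_i)\nabla\zeta_i|^2$ (\<open>picone_inequality\<close>).

The geometric content is therefore Green's formula for a compactly supported test function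
(\<open>green\<close>). It is reduced to the vanishing of $\int \partial_i F$ for compactly supported $C^1$
functions on \<open>real ^ 'n\<close>, by cutting the test function into finitely many pieces that are supported in
charts. Two facts make the local computation meaningful. The volume measure exists and is unique, which
rests on the change of variables formula for the transition maps. The Laplacian is the same in all
charts: its weak form, $-\int\langle\nabla\psi,\nabla f\rangle$, involves only first derivatives, whose
transformation is elementary, and testing with bump functions recovers the pointwise values
(\<open>laplace_chart_le\<close>).
\<close>

section \<open>Change of variables for the Lebesgue measure\<close>

text \<open>
A well-ordered copy of an arbitrary finite type. Gaussian elimination, and with it the change of
variables theorem, is formulated for matrices whose index type is well-ordered; relabelling the
coordinates transports the theorem to every finite index type.
\<close>

typedef ('n::finite) index = "{..<CARD('n)}"
  by (rule exI[of _ 0]) simp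

instantiation index :: (finite) "{finite, wellorder}"
begin

definition less_eq_index :: "'a index \<Rightarrow> 'a index \<Rightarrow> bool" where
  "less_eq_index x y \<longleftrightarrow> Rep_index x \<le> Rep_index y"

definition less_index :: "'a index \<Rightarrow> 'a index \<Rightarrow> bool" where
  "less_index x y \<longleftrightarrow> Rep_index x < Rep_index y"

instance
proof
  show "finite (UNIV :: 'a index set)"
    by (metis (mono_tags, lifting) Rep_index_inject UNIV_I finite_imageD finite_lessThan
        inj_onI type_definition.Rep_range type_definition_index)
next
  fix P :: "'a index \<Rightarrow> bool" and a
  assume step: "\<And>x. (\<And>y. y < x \<Longrightarrow> P y) \<Longrightarrow> P x"
  show "P a"
    by (induction a rule: measure_induct_rule[of Rep_index]) (rule step, simp add: less_index_def)
qed (auto simp: less_eq_index_def less_index_def Rep_index_inject)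

end

lemma ex_bij_index: "\<exists>e :: ('n::finite) index \<Rightarrow> 'n. bij e"
proof -
  have "CARD('n index) = CARD('n)"
    using type_definition.card[OF type_definition_index] by simp
  then show ?thesis
    using finite_same_card_bij[of "UNIV :: 'n index set" "UNIV :: 'n set"] by simp
qed

text \<open>
Conjugation with \<open>e\<close> is a sign-preserving bijection between the permutations of the two index types.
\<close>

lemma det_reindex:
  fixes e :: "'w::finite \<Rightarrow> 'n::finite" and M :: "real ^ 'n ^ 'n"
  assumes e: "bij e"
  shows "det (\<chi> i j. M $ e i $ e j) = det M"
proof -
  define F where "F = (\<lambda>p x. e (p (inv e x)))"
  have inj: "inj e" and inve: "\<And>x. inv e (e x) = x" "\<And>x. e (inv e x) = x"
    using e by (auto simp: bij_is_inj bij_is_surj surj_f_inv_f)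
  have F: "bij_betw F {p. p permutes UNIV} {p. p permutes UNIV}"
    using bij_betw_permutations[OF e] by (simp add: F_def)
  have sgn: "sign (F p) = sign p" if "p permutes UNIV" for p
  proof -
    have "map_permutation UNIV e p = F p"
      using e by (auto simp: map_permutation_def F_def restrict_id_def bij_is_surj fun_eq_iff)
    then show ?thesis
      using sign_map_permutation[OF inj that] by simp
  qed
  have "det M = (\<Sum>p | p permutes UNIV. of_int (sign (F p)) * (\<Prod>i\<in>UNIV. M $ i $ F p i))"
    unfolding det_def by (rule sum.reindex_bij_betw[OF F, symmetric])
  also have "\<dots> = (\<Sum>p | p permutes UNIV. of_int (sign p) * (\<Prod>i\<in>UNIV. M $ e i $ e (p i)))"
  proof (rule sum.cong[OF refl])
    fix p :: "'w \<Rightarrow> 'w" assume "p \<in> {p. p permutes UNIV}"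
    moreover have "(\<Prod>i\<in>UNIV. M $ i $ F p i) = (\<Prod>i\<in>UNIV. M $ e i $ F p (e i))"
      by (rule prod.reindex_bij_betw[OF e, symmetric])
    ultimately show "of_int (sign (F p)) * (\<Prod>i\<in>UNIV. M $ i $ F p i) =
        of_int (sign p) * (\<Prod>i\<in>UNIV. M $ e i $ e (p i))"
      by (simp add: sgn) (simp add: F_def inve)
  qed
  finally show ?thesis by (simp add: det_def)
qed

definition reindex :: "('w \<Rightarrow> 'n) \<Rightarrow> real ^ 'n \<Rightarrow> real ^ 'w" where
  "reindex e x = (\<chi> i. x $ e i)"

lemma bounded_linear_reindex: "bounded_linear (reindex e :: real ^ 'n::finite \<Rightarrow> real ^ 'w::finite)"
  by (rule linear_conv_bounded_linear[THEN iffD1], rule linearI) (auto simp: reindex_def vec_eq_iff)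

lemma reindex_reindex:
  assumes "bij e"
  shows "reindex e (reindex (inv e) x) = x" "reindex (inv e) (reindex e y) = y"
  using assms by (auto simp: reindex_def vec_eq_iff bij_is_inj bij_is_surj surj_f_inv_f)

lemma distr_lborel_reindex:
  fixes e :: "'w::finite \<Rightarrow> 'n::finite"
  assumes e: "bij e"
  shows "distr lborel borel (reindex e) = (lborel :: (real ^ 'w) measure)"
proof (rule lborel_eqI[symmetric])
  have [measurable]: "(reindex e :: real ^ 'n \<Rightarrow> real ^ 'w) \<in> borel_measurable borel"
    by (intro borel_measurable_continuous_onI linear_continuous_on bounded_linear_reindex)
  fix l u :: "real ^ 'w"
  assume le: "\<And>b. b \<in> Basis \<Longrightarrow> l \<bullet> b \<le> u \<bullet> b"
  then have le': "l $ i \<le> u $ i" for i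
    by (metis axis_in_Basis_iff cart_eq_inner_axis insertI1 Basis_real_def)
  have eq: "reindex e -` box l u = box (reindex (inv e) l) (reindex (inv e) u)"
  proof -
    have "(\<forall>i. l $ i < x $ e i \<and> x $ e i < u $ i) \<longleftrightarrow>
        (\<forall>j. l $ inv e j < x $ j \<and> x $ j < u $ inv e j)" for x :: "real ^ 'n"
      using e by (metis bij_inv_eq_iff)
    then show ?thesis by (auto simp: reindex_def mem_box_cart)
  qed
  have "emeasure (distr lborel borel (reindex e)) (box l u) = emeasure lborel (reindex e -` box l u)"
    by (subst emeasure_distr) auto
  also have "\<dots> = (\<Prod>b\<in>Basis. (reindex (inv e) u - reindex (inv e) l) \<bullet> b)"
    unfolding eq
  proof (rule emeasure_lborel_box)
    fix b :: "real ^ 'n" assume "b \<in> Basis"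
    then obtain j where "b = axis j 1" by (auto simp: Basis_vec_def)
    then show "reindex (inv e) l \<bullet> b \<le> reindex (inv e) u \<bullet> b"
      using le' by (simp add: reindex_def inner_axis)
  qed
  also have "(\<Prod>b\<in>Basis. (reindex (inv e) u - reindex (inv e) l) \<bullet> b) = (\<Prod>j\<in>UNIV. (u - l) $ inv e j)"
    by (simp add: Basis_vec_def UNION_singleton_eq_range prod.reindex inj_on_def axis_eq_axis
        inner_axis reindex_def)
  also have "\<dots> = (\<Prod>i\<in>UNIV. (u - l) $ i)"
    by (rule prod.reindex_bij_betw) (rule bij_imp_bij_inv[OF e])
  also have "\<dots> = (\<Prod>b\<in>Basis. (u - l) \<bullet> b)"
    by (simp add: Basis_vec_def UNION_singleton_eq_range prod.reindex inj_on_def axis_eq_axis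
        inner_axis)
  finally show "emeasure (distr lborel borel (reindex e)) (box l u) = (\<Prod>b\<in>Basis. (u - l) \<bullet> b)" .
qed simp

text \<open>
Equality of absolute integrals is enough for equality in the extended nonnegative reals: when one
side is infinite, neither function is absolutely integrable, so both sides are infinite.
\<close>

lemma nn_integral_eq_iff_absolutely_integrable:
  fixes f g :: "'a::euclidean_space \<Rightarrow> real"
  assumes f: "f \<in> borel_measurable borel" "\<And>x. 0 \<le> f x"
    and g: "g \<in> borel_measurable borel" "\<And>x. 0 \<le> g x"
    and iff: "\<And>b. f absolutely_integrable_on UNIV \<and> integral UNIV f = b \<longleftrightarrow>
                   g absolutely_integrable_on UNIV \<and> integral UNIV g = b"
  shows "(\<integral>\<^sup>+x. f x \<partial>lborel) = (\<integral>\<^sup>+x. g x \<partial>lborel)"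
proof -
  have abs_iff: "integrable lborel h \<longleftrightarrow> h absolutely_integrable_on UNIV"
    if "h \<in> borel_measurable borel" for h :: "'a \<Rightarrow> real"
    using that integrable_completion[of h lborel] by (simp add: set_integrable_def)
  show ?thesis
  proof (cases "integrable lborel f")
    case True
    then have "g absolutely_integrable_on UNIV" "integral UNIV f = integral UNIV g"
      using iff abs_iff[OF f(1)] by blast+
    then have "integrable lborel g" using abs_iff[OF g(1)] by blast
    moreover from this True have "integral\<^sup>L lborel f = integral\<^sup>L lborel g"
      using \<open>integral UNIV f = integral UNIV g\<close> by (metis integral_lborel)
    ultimately show ?thesis
      using True f g by (simp add: nn_integral_eq_integral)
  next
    case False
    then have "\<not> integrable lborel g"
      using iff abs_iff[OF f(1)] abs_iff[OF g(1)] by blast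
    with False f g show ?thesis
      by (simp add: integrable_iff_bounded) (simp add: less_top[symmetric])
  qed
qed

lemma nn_integral_change_of_variables_wellorder:
  fixes \<tau> :: "real ^ 'm::{finite,wellorder} \<Rightarrow> real ^ 'm::_" and h :: "real ^ 'm::_ \<Rightarrow> real"
  assumes S: "S \<in> sets borel"
    and der: "\<And>x. x \<in> S \<Longrightarrow> (\<tau> has_derivative \<tau>' x) (at x within S)"
    and inj: "inj_on \<tau> S"
    and h: "\<And>y. 0 \<le> h y" "(\<lambda>y. indicator (\<tau> ` S) y * h y) \<in> borel_measurable borel"
    and h\<tau>: "(\<lambda>x. indicator S x * (\<bar>det (matrix (\<tau>' x))\<bar> * h (\<tau> x))) \<in> borel_measurable borel"
  shows "(\<integral>\<^sup>+y. ennreal (indicator (\<tau> ` S) y * h y) \<partial>lborel) =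
    (\<integral>\<^sup>+x. ennreal (indicator S x * (\<bar>det (matrix (\<tau>' x))\<bar> * h (\<tau> x))) \<partial>lborel)"
proof (rule nn_integral_eq_iff_absolutely_integrable)
  let ?v = "vec :: real \<Rightarrow> real ^ 1"
  let ?F = "\<lambda>x. \<bar>det (matrix (\<tau>' x))\<bar> * h (\<tau> x)"
  have S': "S \<in> sets lebesgue" using S by simp
  have restrict: "f absolutely_integrable_on T \<and> integral T f = b \<longleftrightarrow>
      (\<lambda>x. indicator T x * f x) absolutely_integrable_on UNIV \<and>
      integral UNIV (\<lambda>x. indicator T x * f x) = b" for T b and f :: "real ^ 'm::_ \<Rightarrow> real"
  proof -
    have *: "(\<lambda>x. indicator T x * f x) = (\<lambda>x. if x \<in> T then f x else 0)" by auto
    show ?thesis unfolding * by (simp add: absolutely_integrable_restrict_UNIV integral_restrict_UNIV)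
  qed
  fix b
  have "(\<lambda>x. \<bar>det (matrix (\<tau>' x))\<bar> *\<^sub>R ?v (h (\<tau> x))) absolutely_integrable_on S \<and>
        integral S (\<lambda>x. \<bar>det (matrix (\<tau>' x))\<bar> *\<^sub>R ?v (h (\<tau> x))) = ?v b \<longleftrightarrow>
        (\<lambda>x. ?v (h x)) absolutely_integrable_on (\<tau> ` S) \<and> integral (\<tau> ` S) (\<lambda>x. ?v (h x)) = ?v b"
    by (rule has_absolute_integral_change_of_variables[OF S' der inj])
  then have "?F absolutely_integrable_on S \<and> integral S ?F = b \<longleftrightarrow>
      h absolutely_integrable_on (\<tau> ` S) \<and> integral (\<tau> ` S) h = b"
    unfolding absolutely_integrable_on_1_iff integral_on_1_eq by simp
  then show "(\<lambda>y. indicator (\<tau> ` S) y * h y) absolutely_integrable_on UNIV \<and>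
      integral UNIV (\<lambda>y. indicator (\<tau> ` S) y * h y) = b \<longleftrightarrow>
      (\<lambda>x. indicator S x * ?F x) absolutely_integrable_on UNIV \<and>
      integral UNIV (\<lambda>x. indicator S x * ?F x) = b"
    unfolding restrict[symmetric] by blast
qed (use h h\<tau> in auto)

text \<open>
The relabelling \<open>reindex\<close> of coordinates preserves the Lebesgue measure and conjugates \<open>\<tau>\<close> to a map
with the same Jacobian determinant on a space with a well-ordered index type.
\<close>

lemma nn_integral_change_of_variables:
  fixes \<tau> :: "real ^ 'n::finite \<Rightarrow> real ^ 'n" and h :: "real ^ 'n \<Rightarrow> real"
  assumes S: "S \<in> sets borel"
    and der: "\<And>x. x \<in> S \<Longrightarrow> (\<tau> has_derivative \<tau>' x) (at x within S)"
    and inj: "inj_on \<tau> S"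
    and h: "\<And>y. 0 \<le> h y" "(\<lambda>y. indicator (\<tau> ` S) y * h y) \<in> borel_measurable borel"
    and h\<tau>: "(\<lambda>x. indicator S x * (\<bar>det (matrix (\<tau>' x))\<bar> * h (\<tau> x))) \<in> borel_measurable borel"
  shows "(\<integral>\<^sup>+y. ennreal (indicator (\<tau> ` S) y * h y) \<partial>lborel) =
    (\<integral>\<^sup>+x. ennreal (indicator S x * (\<bar>det (matrix (\<tau>' x))\<bar> * h (\<tau> x))) \<partial>lborel)"
proof -
  obtain e :: "'n index \<Rightarrow> 'n" where e: "bij e" using ex_bij_index by blast
  define P :: "real ^ 'n \<Rightarrow> real ^ 'n index" where "P = reindex e"
  define Q :: "real ^ 'n index \<Rightarrow> real ^ 'n" where "Q = reindex (inv e)"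
  have bl: "bounded_linear P" "bounded_linear Q"
    unfolding P_def Q_def by (rule bounded_linear_reindex)+
  have PQ: "P (Q y) = y" and QP: "Q (P x) = x" for x y
    unfolding P_def Q_def by (rule reindex_reindex[OF e])+
  have [measurable]: "P \<in> borel_measurable borel" "Q \<in> borel_measurable borel"
    using bl by (auto intro!: borel_measurable_continuous_onI linear_continuous_on)
  have lborel_Q: "distr lborel borel Q = lborel"
    unfolding Q_def by (rule distr_lborel_reindex[OF bij_imp_bij_inv[OF e]])
  have subst: "(\<integral>\<^sup>+x. f x \<partial>lborel) = (\<integral>\<^sup>+y. f (Q y) \<partial>lborel)"
    if [measurable]: "f \<in> borel_measurable borel" for f :: "real ^ 'n \<Rightarrow> ennreal"
    by (subst lborel_Q[symmetric], subst nn_integral_distr) auto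
  \<comment> \<open>\<open>\<sigma>\<close> is \<open>\<tau>\<close> in the relabelled coordinates.\<close>
  define \<sigma> where "\<sigma> = P \<circ> \<tau> \<circ> Q"
  define \<sigma>' where "\<sigma>' = (\<lambda>y. P \<circ> \<tau>' (Q y) \<circ> Q)"
  have S': "P ` T = Q -` T" for T
    using QP by (auto simp: image_iff) (metis PQ)
  have img: "\<sigma> ` (P ` S) = Q -` (\<tau> ` S)"
    unfolding \<sigma>_def S'[symmetric] by (simp add: image_comp QP comp_def)
  have ind: "indicator (P ` S) y = (indicator S (Q y) :: real)"
    "indicator (\<sigma> ` (P ` S)) y = (indicator (\<tau> ` S) (Q y) :: real)" for y
    unfolding img by (auto simp: S' indicator_def)
  have det: "det (matrix (\<sigma>' y)) = det (matrix (\<tau>' (Q y)))" for y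
  proof -
    have "Q (axis i 1) = axis (e i) 1" for i
      using e unfolding Q_def reindex_def
      by (auto simp: vec_eq_iff axis_def bij_is_inj bij_is_surj surj_f_inv_f)
    then have "matrix (\<sigma>' y) = (\<chi> i j. matrix (\<tau>' (Q y)) $ e i $ e j)"
      by (simp add: matrix_def \<sigma>'_def P_def reindex_def)
    then show ?thesis using det_reindex[OF e] by simp
  qed
  have "(\<integral>\<^sup>+y. ennreal (indicator (\<tau> ` S) y * h y) \<partial>lborel) =
      (\<integral>\<^sup>+y. ennreal (indicator (\<sigma> ` (P ` S)) y * h (Q y)) \<partial>lborel)"
    unfolding ind using h(2) by (subst subst) auto
  also have "\<dots> = (\<integral>\<^sup>+y. ennreal (indicator (P ` S) y * (\<bar>det (matrix (\<sigma>' y))\<bar> * h (Q (\<sigma> y)))) \<partial>lborel)"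
  proof (rule nn_integral_change_of_variables_wellorder)
    show "P ` S \<in> sets borel"
      unfolding S' using measurable_sets[of Q borel borel S] S by simp
    show "inj_on \<sigma> (P ` S)"
      using inj unfolding \<sigma>_def inj_on_def by (auto simp: QP) (metis QP)
    fix y assume y: "y \<in> P ` S"
    then have Qy: "Q y \<in> S" by (auto simp: QP)
    have "(\<tau> has_derivative \<tau>' (Q y)) (at (Q y) within Q ` P ` S)"
      using der[OF Qy] by (simp add: image_comp QP)
    then have "((\<lambda>x. \<tau> (Q x)) has_derivative (\<lambda>x. \<tau>' (Q y) (Q x))) (at y within P ` S)"
      by (rule has_derivative_in_compose[rotated])
        (rule bounded_linear_imp_has_derivative[OF bl(2)])
    then show "(\<sigma> has_derivative \<sigma>' y) (at y within P ` S)"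
      unfolding \<sigma>_def \<sigma>'_def comp_def
      by (rule bounded_linear.has_derivative[OF bl(1)])
  next
    show "(\<lambda>y. indicator (\<sigma> ` P ` S) y * h (Q y)) \<in> borel_measurable borel"
      unfolding ind using measurable_compose[OF \<open>Q \<in> borel_measurable borel\<close> h(2)] by simp
    show "(\<lambda>x. indicator (P ` S) x * (\<bar>det (matrix (\<sigma>' x))\<bar> * h (Q (\<sigma> x)))) \<in> borel_measurable borel"
      unfolding ind det using measurable_compose[OF \<open>Q \<in> borel_measurable borel\<close> h\<tau>]
      by (simp add: \<sigma>_def QP)
  qed (use h in auto)
  also have "\<dots> = (\<integral>\<^sup>+y. ennreal (indicator S (Q y) * (\<bar>det (matrix (\<tau>' (Q y)))\<bar> * h (\<tau> (Q y)))) \<partial>lborel)"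
    unfolding ind det by (simp add: \<sigma>_def QP)
  also have "\<dots> = (\<integral>\<^sup>+x. ennreal (indicator S x * (\<bar>det (matrix (\<tau>' x))\<bar> * h (\<tau> x))) \<partial>lborel)"
    using h\<tau> by (subst subst) auto
  finally show ?thesis .
qed

section \<open>Functions of class $C^1$ on open sets\<close>

text \<open>
An opaque name for \<open>Ck_on 1\<close>, which the simplifier would otherwise unfold into its two conjuncts.
\<close>

definition C1_on :: "'e set \<Rightarrow> ('e::real_normed_vector \<Rightarrow> 'f::real_normed_vector) \<Rightarrow> bool" where
  "C1_on S f \<longleftrightarrow> Ck_on 1 S f"

lemma C1_onI:
  assumes "\<And>x. x \<in> S \<Longrightarrow> (f has_derivative f' x) (at x)"
    and "\<And>v. continuous_on S (\<lambda>x. f' x v)"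
  shows "C1_on S f"
proof -
  have "frechet_derivative f (at x) = f' x" if "x \<in> S" for x
    using frechet_derivative_at[OF assms(1)[OF that]] by simp
  then have "continuous_on S (\<lambda>x. frechet_derivative f (at x) v)" for v
    using assms(2)[of v] by (subst continuous_on_cong[OF refl, of _ _ "\<lambda>x. f' x v"]) auto
  then show ?thesis
    using assms(1) by (auto simp: C1_on_def differentiable_def)
qed

lemma C1_onD:
  assumes "C1_on S f"
  shows "x \<in> S \<Longrightarrow> (f has_derivative frechet_derivative f (at x)) (at x)"
    and "continuous_on S (\<lambda>x. frechet_derivative f (at x) v)"
  using assms by (simp_all add: C1_on_def frechet_derivative_works)

lemma C1_on_differentiable: "C1_on S f \<Longrightarrow> x \<in> S \<Longrightarrow> f differentiable (at x)"
  unfolding C1_on_def by (simp only: Ck_on.simps One_nat_def)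

lemma C1_on_imp_continuous_on: "C1_on S f \<Longrightarrow> continuous_on S f"
  using differentiable_imp_continuous_within[OF C1_on_differentiable]
  by (intro continuous_at_imp_continuous_on) blast

lemma continuous_on_partial: "C1_on S f \<Longrightarrow> continuous_on S (partial i f)"
  by (auto simp: C1_on_def partial_def[abs_def])

lemma C1_on_subset: "C1_on S f \<Longrightarrow> T \<subseteq> S \<Longrightarrow> C1_on T f"
  by (auto simp: C1_on_def intro: continuous_on_subset)

lemma Ck_on_SucD: "Ck_on (Suc k) S f \<Longrightarrow> Ck_on k S f"
proof (induction k arbitrary: f)
  case 0
  then show ?case
    using C1_on_imp_continuous_on[of S f] by (simp add: C1_on_def)
qed auto

lemma Ck_on_imp_C1_on: "Ck_on (Suc k) S f \<Longrightarrow> C1_on S f"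
proof (induction k)
  case (Suc k)
  then show ?case using Ck_on_SucD[of "Suc k" S f] by (simp only:)
qed (simp only: C1_on_def One_nat_def)

lemma Ck_on_partial: "Ck_on (Suc k) S f \<Longrightarrow> Ck_on k S (partial i f)"
  by (auto simp: partial_def[abs_def])

lemma C1_on_cong:
  assumes S: "open S" and eq: "\<And>x. x \<in> S \<Longrightarrow> f x = h x" and f: "C1_on S f"
  shows "C1_on S h"
proof -
  define f' where "f' x = frechet_derivative f (at x)" for x
  note f' = C1_onD[OF f, folded f'_def]
  show ?thesis
  proof (rule C1_onI[OF _ f'(2)])
    show "(h has_derivative f' x) (at x)" if "x \<in> S" for x
      by (rule has_derivative_transform_within_open[OF f'(1)[OF that] S that eq])
  qed
qed

lemma C1_on_Un:
  assumes "open S" "open T" "C1_on S f" "C1_on T f"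
  shows "C1_on (S \<union> T) f"
proof (rule C1_onI[where f' = "\<lambda>x. frechet_derivative f (at x)"])
  show "(f has_derivative frechet_derivative f (at x)) (at x)" if "x \<in> S \<union> T" for x
    using that assms(3,4) C1_on_differentiable frechet_derivative_works by blast
  show "continuous_on (S \<union> T) (\<lambda>x. frechet_derivative f (at x) v)" for v
    using assms by (intro continuous_on_open_Un) (simp_all add: C1_on_def)
qed

lemma C1_on_const: "C1_on S (\<lambda>x. c)"
  by (rule C1_onI[where f' = "\<lambda>x v. 0"]) auto

lemma C1_on_add:
  assumes "C1_on S f" "C1_on S h"
  shows "C1_on S (\<lambda>x. f x + h x)"
proof -
  define f' where "f' x = frechet_derivative f (at x)" for x
  note f' = C1_onD[OF assms(1), folded f'_def]
  define h' where "h' x = frechet_derivative h (at x)" for x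
  note h' = C1_onD[OF assms(2), folded h'_def]
  show ?thesis
    by (rule C1_onI[where f' = "\<lambda>x v. f' x v + h' x v"])
      (intro has_derivative_add continuous_intros f' h'; assumption)+
qed

lemma C1_on_mult:
  fixes f h :: "'e::real_normed_vector \<Rightarrow> real"
  assumes "C1_on S f" "C1_on S h"
  shows "C1_on S (\<lambda>x. f x * h x)"
proof -
  define f' where "f' x = frechet_derivative f (at x)" for x
  note f' = C1_onD[OF assms(1), folded f'_def]
  define h' where "h' x = frechet_derivative h (at x)" for x
  note h' = C1_onD[OF assms(2), folded h'_def]
  show ?thesis
    by (rule C1_onI[where f' = "\<lambda>x v. f x * h' x v + f' x v * h x"])
      (intro has_derivative_mult continuous_intros f' h' C1_on_imp_continuous_on assms; assumption)+
qed

lemma C1_on_sum: "(\<And>i. i \<in> I \<Longrightarrow> C1_on S (f i)) \<Longrightarrow> C1_on S (\<lambda>x. \<Sum>i\<in>I. f i x)"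
  by (induction I rule: infinite_finite_induct) (auto intro: C1_on_const C1_on_add)

lemma C1_on_prod:
  fixes f :: "'i \<Rightarrow> 'e::real_normed_vector \<Rightarrow> real"
  shows "(\<And>i. i \<in> I \<Longrightarrow> C1_on S (f i)) \<Longrightarrow> C1_on S (\<lambda>x. \<Prod>i\<in>I. f i x)"
  by (induction I rule: infinite_finite_induct) (auto intro: C1_on_const C1_on_mult)

lemma C1_on_real_comp:
  fixes f :: "'e::real_normed_vector \<Rightarrow> real"
  assumes f: "C1_on S f" and r: "\<And>x. x \<in> S \<Longrightarrow> (r has_field_derivative r' (f x)) (at (f x))"
    and r': "continuous_on (f ` S) r'"
  shows "C1_on S (\<lambda>x. r (f x))"
proof -
  define f' where "f' x = frechet_derivative f (at x)" for x
  note f' = C1_onD[OF f, folded f'_def]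
  show ?thesis
  proof (rule C1_onI[where f' = "\<lambda>x v. f' x v * r' (f x)"])
    fix x assume "x \<in> S"
    show "((\<lambda>x. r (f x)) has_derivative (\<lambda>v. f' x v * r' (f x))) (at x)"
      using has_derivative_compose[OF f'(1)[OF \<open>x \<in> S\<close>], of r "(*) (r' (f x))"] r[OF \<open>x \<in> S\<close>]
      by (simp add: has_field_derivative_def mult.commute)
  next
    fix v show "continuous_on S (\<lambda>x. f' x v * r' (f x))"
      by (intro continuous_intros f' continuous_on_compose2[OF r' C1_on_imp_continuous_on[OF f]]) auto
  qed
qed

lemma C1_on_inverse:
  fixes f :: "'e::real_normed_vector \<Rightarrow> real"
  assumes "C1_on S f" "\<And>x. x \<in> S \<Longrightarrow> f x \<noteq> 0"
  shows "C1_on S (\<lambda>x. inverse (f x))"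
  by (rule C1_on_real_comp[where r' = "\<lambda>t. - inverse (t\<^sup>2)"])
    (use assms in \<open>auto intro!: derivative_eq_intros continuous_intros simp: power2_eq_square\<close>)

lemma C1_on_divide:
  fixes f h :: "'e::real_normed_vector \<Rightarrow> real"
  assumes "C1_on S f" "C1_on S h" "\<And>x. x \<in> S \<Longrightarrow> h x \<noteq> 0"
  shows "C1_on S (\<lambda>x. f x / h x)"
  using C1_on_mult[OF assms(1) C1_on_inverse[OF assms(2,3)]] by (simp add: divide_inverse)

lemma C1_on_sqrt:
  fixes f :: "'e::real_normed_vector \<Rightarrow> real"
  assumes "C1_on S f" "\<And>x. x \<in> S \<Longrightarrow> 0 < f x"
  shows "C1_on S (\<lambda>x. sqrt (f x))"
proof (rule C1_on_real_comp[OF assms(1)])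
  show "(sqrt has_real_derivative inverse (sqrt (f x)) / 2) (at (f x))" if "x \<in> S" for x
    by (rule DERIV_real_sqrt[OF assms(2)[OF that]])
  have "sqrt t \<noteq> 0" if "t \<in> f ` S" for t using that assms(2) by force
  then show "continuous_on (f ` S) (\<lambda>t. inverse (sqrt t) / 2)"
    by (intro continuous_intros) auto
qed

lemma C1_on_det:
  fixes M :: "'e::real_normed_vector \<Rightarrow> real ^ 'k::finite ^ 'k"
  assumes "\<And>i j. C1_on S (\<lambda>x. M x $ i $ j)"
  shows "C1_on S (\<lambda>x. det (M x))"
  unfolding det_def by (intro C1_on_sum C1_on_mult C1_on_prod C1_on_const assms)

lemma C1_on_component:
  fixes f :: "'e::real_normed_vector \<Rightarrow> 'f::real_normed_vector ^ 'k::finite"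
  assumes "C1_on S f"
  shows "C1_on S (\<lambda>x. f x $ i)"
proof -
  define f' where "f' x = frechet_derivative f (at x)" for x
  note f' = C1_onD[OF assms, folded f'_def]
  show ?thesis
    by (rule C1_onI[where f' = "\<lambda>x v. f' x v $ i"])
      (intro bounded_linear.has_derivative[OF bounded_linear_vec_nth] continuous_intros f'; assumption)+
qed

text \<open>
Continuity of the derivative is only required for each fixed direction, but the inner derivative
supplies a direction that varies with the point; expanding it in the standard basis reduces one to the
other.
\<close>

lemma C1_on_compose:
  fixes f :: "'e::real_normed_vector \<Rightarrow> 'f::euclidean_space" and h :: "'f \<Rightarrow> 'g::real_normed_vector"
  assumes f: "C1_on S f" and h: "C1_on T h" and sub: "f ` S \<subseteq> T"
  shows "C1_on S (\<lambda>x. h (f x))"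
proof -
  define f' where "f' x = frechet_derivative f (at x)" for x
  note f' = C1_onD[OF f, folded f'_def]
  define h' where "h' x = frechet_derivative h (at x)" for x
  note h' = C1_onD[OF h, folded h'_def]
  show ?thesis
  proof (rule C1_onI[where f' = "\<lambda>x v. \<Sum>b\<in>Basis. (f' x v \<bullet> b) *\<^sub>R h' (f x) b"])
    fix x assume x: "x \<in> S"
    then have "f x \<in> T" using sub by auto
    have "(\<lambda>v. h' (f x) (f' x v)) = (\<lambda>v. \<Sum>b\<in>Basis. (f' x v \<bullet> b) *\<^sub>R h' (f x) b)"
    proof
      fix v
      have lin: "linear (h' (f x))" using h'(1)[OF \<open>f x \<in> T\<close>] has_derivative_linear by blast
      have "h' (f x) (f' x v) = h' (f x) (\<Sum>b\<in>Basis. (f' x v \<bullet> b) *\<^sub>R b)"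
        by (simp add: euclidean_representation)
      also have "\<dots> = (\<Sum>b\<in>Basis. (f' x v \<bullet> b) *\<^sub>R h' (f x) b)"
        using lin by (subst linear_sum) (simp_all add: linear_cmul)
      finally show "h' (f x) (f' x v) = (\<Sum>b\<in>Basis. (f' x v \<bullet> b) *\<^sub>R h' (f x) b)" .
    qed
    then show "((\<lambda>x. h (f x)) has_derivative (\<lambda>v. \<Sum>b\<in>Basis. (f' x v \<bullet> b) *\<^sub>R h' (f x) b)) (at x)"
      using has_derivative_compose[OF f'(1)[OF x] h'(1)[OF \<open>f x \<in> T\<close>]] by simp
  next
    fix v show "continuous_on S (\<lambda>x. \<Sum>b\<in>Basis. (f' x v \<bullet> b) *\<^sub>R h' (f x) b)"
      by (intro continuous_intros f' continuous_on_compose2[OF h'(2) C1_on_imp_continuous_on[OF f] sub])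
  qed
qed

text \<open>
The extension is $C^1$ on \<open>S\<close> and vanishes on the open complement of \<open>K\<close>; the two sets cover the space.
\<close>

lemma C1_on_zero_extension:
  assumes f: "C1_on S f" and S: "open S" and K: "closed K" "K \<subseteq> S"
    and 0: "\<And>x. x \<in> S - K \<Longrightarrow> f x = 0"
  shows "C1_on UNIV (\<lambda>x. if x \<in> S then f x else 0)" (is "C1_on UNIV ?F")
proof -
  have "C1_on S ?F" by (rule C1_on_cong[OF S _ f]) simp
  moreover have "C1_on (- K) ?F"
    by (rule C1_on_cong[OF _ _ C1_on_const[of _ 0]]) (use K 0 in auto)
  ultimately have "C1_on (S \<union> - K) ?F" using S K by (intro C1_on_Un) auto
  moreover have "S \<union> - K = UNIV" using K by auto
  ultimately show ?thesis by simp
qed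

lemma partial_eqI: "(f has_derivative f') (at x) \<Longrightarrow> partial i f x = f' (axis i 1)"
  using frechet_derivative_at[of f f' x] by (simp add: partial_def)

lemma partial_mult:
  assumes "f differentiable (at x)" "h differentiable (at x)"
  shows "partial i (\<lambda>y. f y * h y) x = f x * partial i h x + partial i f x * h x"
proof -
  have "((\<lambda>y. f y * h y) has_derivative
      (\<lambda>v. f x * frechet_derivative h (at x) v + frechet_derivative f (at x) v * h x)) (at x)"
    using assms by (intro has_derivative_mult) (auto simp: frechet_derivative_works)
  from partial_eqI[OF this] show ?thesis by (simp add: partial_def)
qed

lemma partial_cong:
  assumes "open S" "x \<in> S" "\<And>y. y \<in> S \<Longrightarrow> f y = h y"
  shows "partial i f x = partial i h x"
proof -
  have "(f has_derivative F) (at x) \<longleftrightarrow> (h has_derivative F) (at x)" for F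
    using has_derivative_transform_within_open[of f F x UNIV S h]
      has_derivative_transform_within_open[of h F x UNIV S f] assms by auto
  then show ?thesis by (simp add: partial_def frechet_derivative_def)
qed

lemma integrable_continuous_compact_support:
  fixes f :: "'e::euclidean_space \<Rightarrow> real"
  assumes f: "continuous_on UNIV f" and K: "compact K" "\<And>x. x \<notin> K \<Longrightarrow> f x = 0"
  shows "integrable lborel f"
proof -
  have "integrable lborel (\<lambda>x. indicator K x *\<^sub>R f x)"
    by (rule borel_integrable_compact) (use f K in \<open>auto intro: continuous_on_subset\<close>)
  moreover have "(\<lambda>x. indicator K x *\<^sub>R f x) = f" 
  proof
    show "indicator K x *\<^sub>R f x = f x" for x by (cases "x \<in> K") (simp_all add: K(2))
  qed
  ultimately show ?thesis by simp
qed

text \<open>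
By translation invariance the difference quotients in the direction \<open>v\<close> all have integral zero. They
are bounded by the maximum of the derivative and supported in a fixed ball, so that dominated convergence
carries this over to the derivative.
\<close>

lemma integral_directional_derivative_eq_0:
  fixes f :: "'e::euclidean_space \<Rightarrow> real"
  assumes f: "C1_on UNIV f" and K: "compact K" "\<And>x. x \<notin> K \<Longrightarrow> f x = 0"
  shows "(LINT x|lborel. frechet_derivative f (at x) v) = 0"
proof -
  define f' where "f' x = frechet_derivative f (at x)" for x
  have f': "(f has_derivative f' x) (at x)" for x
    using C1_on_differentiable[OF f, of x] unfolding f'_def
    by (simp add: frechet_derivative_works)
  have cont: "continuous_on UNIV (\<lambda>x. f' x v)" for v
    using f unfolding f'_def C1_on_def by simp
  have cf: "continuous_on UNIV f" by (rule C1_on_imp_continuous_on[OF f])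
  have int_f: "integrable lborel f"
    by (rule integrable_continuous_compact_support[OF cf K])
  have f'0: "f' x v = 0" if "x \<notin> K" for x
  proof -
    have "open (- K)" using compact_imp_closed[OF K(1)] by auto
    then have "(f has_derivative (\<lambda>v. 0)) (at x)"
      by (rule has_derivative_transform_within_open[OF has_derivative_const[of 0]])
        (simp_all add: K(2) that)
    from has_derivative_unique[OF f' this] show ?thesis by simp
  qed
  obtain B where B: "\<And>x. \<bar>f' x v\<bar> \<le> B"
  proof -
    have "bounded ((\<lambda>x. f' x v) ` K)"
      by (intro compact_imp_bounded compact_continuous_image K continuous_on_subset[OF cont]) auto
    then obtain B where "\<And>x. x \<in> K \<Longrightarrow> \<bar>f' x v\<bar> \<le> B" "0 < B"
      by (auto simp: bounded_pos)
    then have "\<bar>f' x v\<bar> \<le> B" for x by (cases "x \<in> K") (simp_all add: f'0)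
    then show thesis by (rule that)
  qed
  obtain R where R: "\<And>x. x \<in> K \<Longrightarrow> norm x \<le> R"
    using compact_imp_bounded[OF K(1)] by (auto simp: bounded_iff)
  \<comment> \<open>Steps at most 1 keep the supports of all difference quotients inside one ball.\<close>
  define h where "h k = inverse (real (Suc k))" for k
  have h: "0 < h k" "h k \<le> 1" for k
    by (auto simp: h_def inverse_le_1_iff)
  define q where "q k x = (f (h k *\<^sub>R v + x) - f x) / h k" for k x
  have q_meas: "q k \<in> borel_measurable borel" for k
    unfolding q_def using cf
    by (intro borel_measurable_continuous_onI continuous_intros)
      (auto intro!: continuous_intros continuous_on_compose2[OF cf] simp: h_def)
  have int_q: "(LINT x|lborel. q k x) = 0" for k
  proof -
    have meas: "f \<in> borel_measurable borel" using cf by (rule borel_measurable_continuous_onI)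
    have "integrable (distr lborel borel ((+) (h k *\<^sub>R v))) f"
      using int_f by (simp add: lborel_distr_plus)
    then have i: "integrable lborel (\<lambda>x. f (h k *\<^sub>R v + x))"
      using meas by (subst (asm) integrable_distr_eq) auto
    have "(LINT x|lborel. f x) = (LINT x|distr lborel borel ((+) (h k *\<^sub>R v)). f x)"
      by (simp add: lborel_distr_plus)
    also have "\<dots> = (LINT x|lborel. f (h k *\<^sub>R v + x))"
      using meas by (subst integral_distr) auto
    finally show ?thesis using i int_f by (simp add: q_def)
  qed
  have bound: "norm (q k x) \<le> B * indicator (cball 0 (R + norm v)) x" for k x
  proof (cases "x \<in> K \<or> h k *\<^sub>R v + x \<in> K")
    case True
    have hv: "norm (h k *\<^sub>R v) \<le> norm v"
      using h[of k] by (simp add: mult_left_le_one_le)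
    have "norm x \<le> R + norm v"
    proof (cases "x \<in> K")
      case True
      then show ?thesis using R[of x] norm_ge_zero[of v] by linarith
    next
      case False
      then have "norm (h k *\<^sub>R v + x) \<le> R" using True R by blast
      then show ?thesis using hv norm_triangle_ineq4[of "h k *\<^sub>R v + x" "h k *\<^sub>R v"] by simp
    qed
    moreover have "\<bar>q k x\<bar> \<le> B"
    proof -
      have der: "((\<lambda>t. f (x + t *\<^sub>R v)) has_derivative (\<lambda>s. f' (x + t *\<^sub>R v) (s *\<^sub>R v))) (at t within A)" for t A
        by (rule has_derivative_compose[OF _ f', of "\<lambda>t. x + t *\<^sub>R v" "\<lambda>s. s *\<^sub>R v"])
          (auto intro!: derivative_eq_intros)
      obtain t where "f (x + h k *\<^sub>R v) - f (x + 0 *\<^sub>R v) = f' (x + t *\<^sub>R v) ((h k - 0) *\<^sub>R v)"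
        using mvt_simple[OF h(1)[of k] der] by blast
      moreover have "linear (f' (x + t *\<^sub>R v))" using f' has_derivative_linear by blast
      ultimately have "q k x = f' (x + t *\<^sub>R v) v"
        using h(1)[of k] by (simp add: q_def linear_cmul add.commute)
      then show ?thesis using B by simp
    qed
    ultimately show ?thesis by (simp add: indicator_def)
  next
    case False
    then have "q k x = 0" using K(2) by (simp add: q_def)
    moreover have "0 \<le> B" using B[of x] abs_ge_zero order_trans by blast
    ultimately show ?thesis by simp
  qed
  have lim: "(\<lambda>k. q k x) \<longlonglongrightarrow> f' x v" for x
  proof -
    have "((\<lambda>t. f (x + t *\<^sub>R v)) has_derivative (\<lambda>s. f' (x + 0 *\<^sub>R v) (s *\<^sub>R v))) (at 0)"
      by (rule has_derivative_compose[OF _ f', of "\<lambda>t. x + t *\<^sub>R v" "\<lambda>s. s *\<^sub>R v"])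
        (auto intro!: derivative_eq_intros)
    moreover have "linear (f' x)" using f' has_derivative_linear by blast
    ultimately have "((\<lambda>t. f (x + t *\<^sub>R v)) has_field_derivative f' x v) (at 0)"
      by (simp add: has_vector_derivative_def linear_cmul has_real_derivative_iff_has_vector_derivative)
    then have "((\<lambda>t. (f (x + t *\<^sub>R v) - f x) / t) \<longlongrightarrow> f' x v) (at 0)"
      by (simp add: DERIV_def)
    moreover have "filterlim h (at 0) sequentially"
    proof -
      have "h \<longlonglongrightarrow> 0" unfolding h_def by (rule LIMSEQ_inverse_real_of_nat)
      moreover have "h k \<noteq> 0" for k using h(1)[of k] by simp
      ultimately show ?thesis by (simp add: filterlim_at)
    qed
    ultimately have "(\<lambda>k. (f (x + h k *\<^sub>R v) - f x) / h k) \<longlonglongrightarrow> f' x v"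
      by (rule filterlim_compose[where f = h])
    then show ?thesis by (simp add: q_def add.commute)
  qed
  have "(\<lambda>k. LINT x|lborel. q k x) \<longlonglongrightarrow> (LINT x|lborel. f' x v)"
  proof (rule integral_dominated_convergence[where w = "\<lambda>x. B * indicator (cball 0 (R + norm v)) x"])
    show "integrable lborel (\<lambda>x. B * indicat_real (cball (0::'e) (R + norm v)) x)"
      using emeasure_bounded_finite[of "cball (0::'e) (R + norm v)"]
      by (intro integrable_mult_right integrable_real_indicator) simp_all
    show "(\<lambda>x. f' x v) \<in> borel_measurable lborel"
      using borel_measurable_continuous_onI[OF cont] by simp
    show "q k \<in> borel_measurable lborel" for k using q_meas by simp
    show "AE x in lborel. (\<lambda>k. q k x) \<longlonglongrightarrow> f' x v" using lim by simp
    show "AE x in lborel. norm (q k x) \<le> B * indicator (cball 0 (R + norm v)) x" for k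
      by (rule AE_I2) (rule bound)
  qed
  then have "(LINT x|lborel. f' x v) = 0"
    unfolding int_q by (rule LIMSEQ_unique[OF tendsto_const, symmetric])
  then show ?thesis by (simp add: f'_def)
qed

text \<open>
Squaring removes the kink of the positive part at zero. This produces compactly supported $C^1$ bumps
from polynomials.
\<close>

lemma C1_on_positive_part_square:
  fixes f :: "'e::real_normed_vector \<Rightarrow> real"
  assumes "C1_on S f"
  shows "C1_on S (\<lambda>x. (max 0 (f x))\<^sup>2)"
proof (rule C1_on_real_comp[OF assms, where r = "\<lambda>t. (max 0 t)\<^sup>2" and r' = "\<lambda>t. 2 * max 0 t"])
  show "continuous_on (f ` S) (\<lambda>t. 2 * max 0 t)" by (intro continuous_intros)
  show "((\<lambda>t. (max 0 t)\<^sup>2) has_real_derivative 2 * max 0 (f x)) (at (f x))" for x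
  proof -
    have "((\<lambda>t. (max 0 t)\<^sup>2) has_real_derivative 2 * max 0 t) (at t)" for t :: real
    proof (cases "t = 0")
      case False
      show ?thesis
      proof (cases "0 < t")
        case True
        have "((\<lambda>t. t\<^sup>2) has_real_derivative 2 * max 0 t) (at t)"
          using True by (auto intro!: derivative_eq_intros)
        then show ?thesis
          by (rule has_field_derivative_transform_within_open[of _ _ _ "{0<..}"]) (use True in auto)
      next
        case neg: False
        have "((\<lambda>t. 0) has_real_derivative 2 * max 0 t) (at t)"
          using neg by auto
        then show ?thesis
          by (rule has_field_derivative_transform_within_open[of _ _ _ "{..<0}"]) (use neg False in auto)
      qed
    next
      case True
      have "((\<lambda>h. (max 0 (0 + h))\<^sup>2 / h) \<longlongrightarrow> 0) (at (0::real))"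
      proof (rule tendsto_rabs_zero_cancel,
          rule tendsto_sandwich[where f = "\<lambda>h. 0" and h = "\<lambda>h. \<bar>h\<bar>"])
        have "\<bar>(max 0 (0 + h))\<^sup>2 / h\<bar> \<le> \<bar>h\<bar>" for h :: real
          by (cases "0 < h") (simp_all add: max_def power2_eq_square)
        then show "\<forall>\<^sub>F h in at 0. \<bar>(max 0 (0 + h))\<^sup>2 / h\<bar> \<le> \<bar>h :: real\<bar>"
          by simp
        show "((\<lambda>h. \<bar>h\<bar>) \<longlongrightarrow> 0) (at (0::real))"
          by (rule tendsto_rabs_zero) (rule tendsto_ident_at)
      qed simp_all
      then show ?thesis using True by (simp add: DERIV_def)
    qed
    then show ?thesis .
  qed
qed

section \<open>Matrices\<close>

lemma matrix_inv_mult_vec: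
  fixes M :: "real ^ 'n ^ 'n"
  assumes "det M \<noteq> 0"
  shows "M *v (matrix_inv M *v b) = b" "matrix_inv M *v (M *v b) = b"
proof -
  have "M ** matrix_inv M = mat 1 \<and> matrix_inv M ** M = mat 1"
    using assms unfolding invertible_det_nz[symmetric] invertible_def matrix_inv_def
    by (rule someI_ex)
  then show "M *v (matrix_inv M *v b) = b" "matrix_inv M *v (M *v b) = b"
    by (simp_all add: matrix_vector_mul_assoc)
qed

text \<open>
On the segment from the identity to \<open>M\<close> all matrices are positive definite and hence invertible, so
the determinant keeps the sign that it has at the identity.
\<close>

lemma det_pos_if_positive_definite:
  fixes M :: "real ^ 'n ^ 'n"
  assumes M: "\<And>v. v \<noteq> 0 \<Longrightarrow> v \<bullet> (M *v v) > 0"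
  shows "0 < det M"
proof (rule ccontr)
  define N where "N t = (1 - t) *\<^sub>R mat 1 + t *\<^sub>R M" for t :: real
  have nz: "det (N t) \<noteq> 0" if t: "0 \<le> t" "t \<le> 1" for t
  proof -
    have "v = 0" if v: "N t *v v = 0" for v
    proof (rule ccontr)
      assume "v \<noteq> 0"
      have "N t *v v = (1 - t) *\<^sub>R v + t *\<^sub>R (M *v v)"
        by (simp add: N_def matrix_vector_mult_add_rdistrib scaleR_matrix_vector_assoc[symmetric])
      then have "0 = (1 - t) * (v \<bullet> v) + t * (v \<bullet> (M *v v))"
        using v by (simp add: inner_add_right[symmetric] inner_scaleR_right[symmetric]
            del: inner_add_right inner_scaleR_right)
      moreover have "0 \<le> t * (v \<bullet> (M *v v))" "0 \<le> (1 - t) * (v \<bullet> v)" "0 < v \<bullet> v"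
        using t M[OF \<open>v \<noteq> 0\<close>] \<open>v \<noteq> 0\<close> by auto
      moreover have "0 < (1 - t) * (v \<bullet> v) \<or> 0 < t * (v \<bullet> (M *v v))"
        using t M[OF \<open>v \<noteq> 0\<close>] \<open>0 < v \<bullet> v\<close> by (cases "t = 0") auto
      ultimately show False by linarith
    qed
    then have "\<exists>B. B ** N t = mat 1" unfolding matrix_left_invertible_ker by blast
    then show ?thesis unfolding invertible_det_nz[symmetric] invertible_left_inverse .
  qed
  assume "\<not> 0 < det M"
  moreover have "N 0 = mat 1" "N 1 = M" by (simp_all add: N_def)
  ultimately have "det (N 1) \<le> 0" "0 \<le> det (N 0)" by simp_all
  moreover have "continuous_on {0..1} (\<lambda>t. det (N t))"
    unfolding N_def det_def by (intro continuous_intros)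
  ultimately obtain t where "0 \<le> t" "t \<le> 1" "det (N t) = 0"
    using IVT2'[of "\<lambda>t. det (N t)" 1 0 0] by auto
  then show False using nz by blast
qed

lemma continuous_on_det:
  fixes M :: "'e::topological_space \<Rightarrow> real ^ 'k::finite ^ 'k"
  assumes "\<And>i j. continuous_on S (\<lambda>x. M x $ i $ j)"
  shows "continuous_on S (\<lambda>x. det (M x))"
  unfolding det_def by (intro continuous_intros assms)

section \<open>Charts and the metric in coordinates\<close>

locale riemannian_manifold =
  fixes A :: "('a::{t2_space, second_countable_topology}, 'n::finite) chart set"
    and g :: "('a, 'n) metric_field"
  assumes atlas: "smooth_atlas A" and metric: "riemannian_metric A g"
begin

lemma chart:
  assumes "c \<in> A"
  shows open_chart: "open (fst c)"
    and open_coord_dom: "open (coord_dom c)"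
    and homeo: "homeomorphism (fst c) (coord_dom c) (snd c) (chart_inv c)"
  using atlas assms by (auto simp: smooth_atlas_def is_chart_def)

lemma chart_maps:
  assumes "c \<in> A"
  shows chart_inv_chart: "p \<in> fst c \<Longrightarrow> chart_inv c (snd c p) = p"
    and chart_chart_inv: "x \<in> coord_dom c \<Longrightarrow> snd c (chart_inv c x) = x"
    and chart_in: "p \<in> fst c \<Longrightarrow> snd c p \<in> coord_dom c"
    and chart_inv_in: "x \<in> coord_dom c \<Longrightarrow> chart_inv c x \<in> fst c"
    and continuous_chart: "continuous_on (fst c) (snd c)"
    and continuous_chart_inv: "continuous_on (coord_dom c) (chart_inv c)"
  using homeo[OF assms] by (auto simp: homeomorphism_def)

lemma chart_at_in: "chart_at A p \<in> A" "p \<in> fst (chart_at A p)"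
proof -
  have "p \<in> (\<Union>c\<in>A. fst c)" using atlas unfolding smooth_atlas_def by blast
  then have "\<exists>c. c \<in> A \<and> p \<in> fst c" by blast
  then show "chart_at A p \<in> A" "p \<in> fst (chart_at A p)"
    unfolding chart_at_def using someI_ex[of "\<lambda>c. c \<in> A \<and> p \<in> fst c"] by blast+
qed

lemma open_chart_image:
  assumes c: "c \<in> A" and T: "open T"
  shows "open (snd c ` (fst c \<inter> T))"
proof -
  have "openin (top_of_set (coord_dom c)) (snd c ` (fst c \<inter> T))"
    by (rule homeomorphism_imp_open_map[OF homeo[OF c]]) (simp add: T openin_open_Int)
  then show ?thesis using open_coord_dom[OF c] openin_open_trans by blast
qed

lemma open_chart_inv_image:
  assumes c: "c \<in> A" and T: "open T" "T \<subseteq> coord_dom c"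
  shows "open (chart_inv c ` T)"
proof -
  have "openin (top_of_set (fst c)) (chart_inv c ` T)"
    by (rule homeomorphism_imp_open_map[OF homeomorphism_symD[OF homeo[OF c]]])
      (use T in \<open>simp add: open_subset\<close>)
  then show ?thesis using open_chart[OF c] openin_open_trans by blast
qed

abbreviation overlap where "overlap c d \<equiv> snd c ` (fst c \<inter> fst d)"

lemma open_overlap: "c \<in> A \<Longrightarrow> d \<in> A \<Longrightarrow> open (overlap c d)"
  by (intro open_chart_image open_chart)

lemma overlap_coord_dom: "c \<in> A \<Longrightarrow> x \<in> overlap c d \<Longrightarrow> x \<in> coord_dom c"
  by (auto simp: coord_dom_def)

lemma transition_overlap:
  assumes "c \<in> A" "d \<in> A" "x \<in> overlap c d"
  shows "transition c d x \<in> coord_dom d" "chart_inv d (transition c d x) = chart_inv c x"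
  using assms by (auto simp: transition_def chart_inv_chart chart_in)

lemma C1_on_transition: "c \<in> A \<Longrightarrow> d \<in> A \<Longrightarrow> C1_on (overlap c d) (transition c d)"
  using atlas unfolding smooth_atlas_def smooth_on_def C1_on_def by blast

abbreviation jac where "jac c d x \<equiv> jacobian (transition c d) (at x)"

lemma transition_has_derivative:
  assumes "c \<in> A" "d \<in> A" "x \<in> overlap c d"
  shows "(transition c d has_derivative (*v) (jac c d x)) (at x)"
  using C1_on_differentiable[OF C1_on_transition[OF assms(1,2)] assms(3)]
  by (simp add: jacobian_works)

lemma metric_transition:
  assumes "c \<in> A" "d \<in> A" "x \<in> overlap c d"
  shows "g c x = transpose (jac c d x) ** g d (transition c d x) ** jac c d x"
  using metric assms unfolding riemannian_metric_def Let_def by blast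

lemma metric_pos: "c \<in> A \<Longrightarrow> x \<in> coord_dom c \<Longrightarrow> v \<noteq> 0 \<Longrightarrow> 0 < v \<bullet> (g c x *v v)"
  using metric unfolding riemannian_metric_def by blast

lemma metric_nonneg: "c \<in> A \<Longrightarrow> x \<in> coord_dom c \<Longrightarrow> 0 \<le> v \<bullet> (g c x *v v)"
  using metric_pos[of c x v] by (cases "v = 0") auto

lemma metric_sym:
  assumes "c \<in> A" "x \<in> coord_dom c"
  shows "v \<bullet> (g c x *v w) = w \<bullet> (g c x *v v)"
proof -
  have "transpose (g c x) = g c x" using metric assms unfolding riemannian_metric_def by blast
  then have "v \<bullet> (g c x *v w) = (g c x *v v) \<bullet> w"
    using transpose_matrix_vector[of "g c x" v] dot_lmul_matrix[of v "g c x" w] by simp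
  then show ?thesis by (simp add: inner_commute)
qed

lemma det_metric_pos: "c \<in> A \<Longrightarrow> x \<in> coord_dom c \<Longrightarrow> 0 < det (g c x)"
  by (rule det_pos_if_positive_definite) (rule metric_pos)

lemma C1_on_metric: "c \<in> A \<Longrightarrow> C1_on (coord_dom c) (\<lambda>x. g c x $ i $ j)"
  using metric unfolding riemannian_metric_def smooth_on_def
  by (intro C1_on_component) (unfold C1_on_def, blast)

definition vol :: "('a, 'n) chart \<Rightarrow> real ^ 'n \<Rightarrow> real" where
  "vol c x = sqrt (det (g c x))"

lemma vol_pos: "c \<in> A \<Longrightarrow> x \<in> coord_dom c \<Longrightarrow> 0 < vol c x"
  using det_metric_pos by (simp add: vol_def)

lemma C1_on_vol: "c \<in> A \<Longrightarrow> C1_on (coord_dom c) (vol c)"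
  unfolding vol_def[abs_def] by (intro C1_on_sqrt C1_on_det C1_on_metric det_metric_pos)

lemma vol_transition:
  assumes "c \<in> A" "d \<in> A" "x \<in> overlap c d"
  shows "vol c x = \<bar>det (jac c d x)\<bar> * vol d (transition c d x)"
  unfolding vol_def metric_transition[OF assms]
  by (simp add: det_mul det_transpose real_sqrt_mult)

text \<open>
The transformation law of the metric already forces the Jacobian of a transition map to be
invertible, since the metric is nondegenerate in both charts.
\<close>

lemma det_jac_nonzero:
  assumes "c \<in> A" "d \<in> A" "x \<in> overlap c d"
  shows "det (jac c d x) \<noteq> 0"
  using vol_transition[OF assms] vol_pos[OF assms(1) overlap_coord_dom[OF assms(1,3)]] by auto

text \<open>
The components of the covector $df$ in the chart \<open>c\<close>.
\<close>

definition differential :: "('a, 'n) chart \<Rightarrow> ('a \<Rightarrow> real) \<Rightarrow> real ^ 'n \<Rightarrow> real ^ 'n" where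
  "differential c f x = (\<chi> j. partial j (f \<circ> chart_inv c) x)"

definition C1 :: "('a \<Rightarrow> real) \<Rightarrow> bool" where
  "C1 f \<longleftrightarrow> Ck_manifold A 1 f"

lemma C1_chart: "C1 f \<Longrightarrow> c \<in> A \<Longrightarrow> C1_on (coord_dom c) (f \<circ> chart_inv c)"
  by (auto simp: C1_def Ck_manifold_def C1_on_def)

lemma C1I: "(\<And>c. c \<in> A \<Longrightarrow> C1_on (coord_dom c) (f \<circ> chart_inv c)) \<Longrightarrow> C1 f"
  by (auto simp: C1_def Ck_manifold_def C1_on_def)

lemma continuous_local:
  fixes f :: "'a \<Rightarrow> 'b::topological_space"
  assumes "\<And>c. c \<in> A \<Longrightarrow> continuous_on (fst c) f"
  shows "continuous_on UNIV f"
  unfolding continuous_on_eq_continuous_at[OF open_UNIV]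
proof
  fix p :: 'a
  show "isCont f p"
    using assms[OF chart_at_in(1)[of p]] chart_at_in[of p] open_chart
    by (simp add: continuous_on_eq_continuous_at)
qed

lemma C1_continuous:
  assumes "C1 f"
  shows "continuous_on UNIV f"
proof (rule continuous_local)
  fix c assume c: "c \<in> A"
  have "continuous_on (fst c) (\<lambda>p. (f \<circ> chart_inv c) (snd c p))"
    by (rule continuous_on_compose2[OF C1_on_imp_continuous_on[OF C1_chart[OF assms c]]
          continuous_chart[OF c]]) (auto simp: chart_in[OF c])
  then show "continuous_on (fst c) f"
    by (rule continuous_on_eq) (simp add: chart_inv_chart[OF c])
qed

lemma differential_transition:
  assumes f: "C1 f" and cd: "c \<in> A" "d \<in> A" and x: "x \<in> overlap c d"
  shows "differential c f x = transpose (jac c d x) *v differential d f (transition c d x)"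
proof -
  let ?F = "f \<circ> chart_inv d" and ?y = "transition c d x"
  let ?F' = "frechet_derivative ?F (at ?y)"
  have F': "(?F has_derivative ?F') (at ?y)"
    by (rule C1_onD(1)[OF C1_chart[OF f cd(2)] transition_overlap(1)[OF cd x]])
  have "((\<lambda>z. ?F (transition c d z)) has_derivative (\<lambda>v. ?F' (jac c d x *v v))) (at x)"
    by (rule has_derivative_compose[OF transition_has_derivative[OF cd x] F'])
  then have der: "((f \<circ> chart_inv c) has_derivative (\<lambda>v. ?F' (jac c d x *v v))) (at x)"
    by (rule has_derivative_transform_within_open[OF _ open_overlap[OF cd] x])
      (simp add: transition_overlap[OF cd])
  have lin: "linear ?F'" using F' has_derivative_linear by blast
  have "partial j (f \<circ> chart_inv c) x = (\<Sum>k\<in>UNIV. jac c d x $ k $ j * partial k ?F ?y)" for j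
  proof -
    have "partial j (f \<circ> chart_inv c) x = ?F' (jac c d x *v axis j 1)"
      by (rule partial_eqI[OF der])
    also have "jac c d x *v axis j 1 = (\<Sum>k\<in>UNIV. (jac c d x $ k $ j) *\<^sub>R axis k 1)"
      using basis_expansion[of "column j (jac c d x)"]
      by (simp add: matrix_vector_mult_basis column_def scalar_mult_eq_scaleR)
    also have "?F' \<dots> = (\<Sum>k\<in>UNIV. jac c d x $ k $ j * ?F' (axis k 1))"
      using lin by (subst linear_sum) (simp_all only: linear_cmul real_scaleR_def)
    finally show ?thesis by (simp only: partial_def)
  qed
  then show ?thesis
    by (simp add: differential_def vec_eq_iff matrix_vector_mult_def transpose_def)
qed

text \<open>
$\langle\nabla f,\nabla h\rangle$, written as the pairing $df(\nabla h) = g^{ij}\,\partial_i f\,\partial_j h$.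
\<close>

definition grad_inner_chart where
  "grad_inner_chart c f h x = differential c f x \<bullet> grad_chart g c h x"

lemma grad_chart_eq: "grad_chart g c f x = matrix_inv (g c x) *v differential c f x"
  by (simp add: grad_chart_def differential_def)

lemma metric_grad_chart:
  assumes "c \<in> A" "x \<in> coord_dom c"
  shows "g c x *v grad_chart g c f x = differential c f x"
  unfolding grad_chart_eq using det_metric_pos[OF assms] by (intro matrix_inv_mult_vec) simp

text \<open>
With \<open>D\<close> the Jacobian, covectors pull back by the transpose of \<open>D\<close> and gradients are mapped by \<open>D\<close>;
the two effects cancel in the pairing.
\<close>

lemma grad_inner_chart_transition:
  assumes f: "C1 f" "C1 h" and cd: "c \<in> A" "d \<in> A" and x: "x \<in> overlap c d"
  shows "grad_inner_chart c f h x = grad_inner_chart d f h (transition c d x)"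
proof -
  let ?D = "jac c d x" and ?y = "transition c d x"
  \<comment> \<open>\<open>z\<close> is the gradient in the chart \<open>d\<close>, transported to \<open>c\<close>; it solves the equation that defines
    the gradient in \<open>c\<close>.\<close>
  define z where "z = matrix_inv ?D *v grad_chart g d h ?y"
  have Dz: "?D *v z = grad_chart g d h ?y"
    unfolding z_def by (rule matrix_inv_mult_vec(1)[OF det_jac_nonzero[OF cd x]])
  have "g c x *v z = transpose ?D *v (g d ?y *v (?D *v z))"
    by (simp add: metric_transition[OF cd x] matrix_vector_mul_assoc matrix_mul_assoc)
  also have "\<dots> = differential c h x"
    by (simp add: Dz metric_grad_chart[OF cd(2) transition_overlap(1)[OF cd x]]
        differential_transition[OF f(2) cd x])
  finally have "z = grad_chart g c h x"
    unfolding grad_chart_eq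
    using matrix_inv_mult_vec(2)[of "g c x" z] det_metric_pos[OF cd(1) overlap_coord_dom[OF cd(1) x]]
    by simp
  then have "grad_inner_chart c f h x = (transpose ?D *v differential d f ?y) \<bullet> z"
    by (simp add: grad_inner_chart_def differential_transition[OF f(1) cd x])
  also have "\<dots> = differential d f ?y \<bullet> (?D *v z)"
    by (simp add: transpose_matrix_vector dot_lmul_matrix)
  finally show ?thesis by (simp add: Dz grad_inner_chart_def)
qed

lemma grad_inner_chart_eq_metric:
  assumes "c \<in> A" "x \<in> coord_dom c"
  shows "grad_inner_chart c f h x = grad_chart g c f x \<bullet> (g c x *v grad_chart g c h x)"
  by (subst metric_sym[OF assms]) (simp add: metric_grad_chart[OF assms] grad_inner_chart_def inner_commute)

text \<open>
By Cramer's rule, the gradient inherits its regularity from the metric and the differential: a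
quotient of determinants is as regular as their entries.
\<close>

lemma grad_chart_component:
  assumes "c \<in> A" "x \<in> coord_dom c"
  shows "grad_chart g c f x $ k =
    det (\<chi> i j. if j = k then differential c f x $ i else g c x $ i $ j) / det (g c x)"
proof -
  have "det (g c x) \<noteq> 0" using det_metric_pos[OF assms] by simp
  from iffD1[OF cramer[OF this] metric_grad_chart[OF assms]] show ?thesis
    by (subst vec_eq_iff[THEN iffD1, rule_format]) (assumption, rule vec_lambda_beta)
qed

lemma C1_on_grad_chart:
  assumes c: "c \<in> A" and f: "Ck_manifold A (Suc (Suc k)) f"
  shows "C1_on (coord_dom c) (\<lambda>x. grad_chart g c f x $ i)"
proof -
  let ?N = "\<lambda>x. (\<chi> r s. if s = i then differential c f x $ r else g c x $ r $ s) :: real ^ 'n ^ 'n"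
  have diff: "C1_on (coord_dom c) (\<lambda>x. differential c f x $ j)" for j
  proof -
    have "Ck_on (Suc (Suc k)) (coord_dom c) (f \<circ> chart_inv c)"
      using f c unfolding Ck_manifold_def by blast
    from Ck_on_imp_C1_on[OF Ck_on_partial[OF this, of j]] show ?thesis
      by (simp add: differential_def)
  qed
  have "C1_on (coord_dom c) (\<lambda>x. ?N x $ r $ s)" for r s
    using diff[of r] C1_on_metric[OF c, of r s] by (cases "s = i") simp_all
  then have "C1_on (coord_dom c) (\<lambda>x. det (?N x) / det (g c x))"
    by (intro C1_on_divide C1_on_det C1_on_metric[OF c] less_imp_neq[OF det_metric_pos[OF c], symmetric])
  then show ?thesis
    by (rule C1_on_cong[OF open_coord_dom[OF c], rotated]) (simp add: grad_chart_component[OF c])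
qed

lemma continuous_on_differential:
  assumes "C1 f" "c \<in> A"
  shows "continuous_on (coord_dom c) (differential c f)"
  unfolding differential_def[abs_def]
  by (intro continuous_on_vec_lambda continuous_on_partial C1_chart assms)

lemma continuous_on_grad_inner_chart:
  assumes "C1 f" "C1 h" "c \<in> A"
  shows "continuous_on (coord_dom c) (grad_inner_chart c f h)"
proof -
  let ?N = "\<lambda>k x. (\<chi> i j. if j = k then differential c h x $ i else g c x $ i $ j) :: real ^ 'n ^ 'n"
  have "continuous_on (coord_dom c) (\<lambda>x. \<chi> k. det (?N k x) / det (g c x))"
  proof (intro continuous_on_vec_lambda continuous_on_divide)
    show "continuous_on (coord_dom c) (\<lambda>x. det (g c x))"
      by (intro C1_on_imp_continuous_on C1_on_det C1_on_metric assms)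
    have "continuous_on (coord_dom c) (\<lambda>x. ?N k x $ i $ j)" for i j k
      using continuous_on_component[OF continuous_on_differential[OF assms(2,3)]]
        C1_on_imp_continuous_on[OF C1_on_metric[OF assms(3)]]
      by (cases "j = k") simp_all
    then show "continuous_on (coord_dom c) (\<lambda>x. det (?N k x))" for k
      by (rule continuous_on_det)
    show "\<forall>x\<in>coord_dom c. det (g c x) \<noteq> 0"
      using less_imp_neq[OF det_metric_pos[OF assms(3)], symmetric] by blast
  qed
  then have "continuous_on (coord_dom c) (grad_chart g c h)"
    by (rule continuous_on_eq)
      (rule vec_eq_iff[THEN iffD2], simp add: grad_chart_component[OF assms(3)])
  then show ?thesis
    unfolding grad_inner_chart_def[abs_def]
    by (intro continuous_on_inner continuous_on_differential assms)
qed

definition grad_inner :: "('a \<Rightarrow> real) \<Rightarrow> ('a \<Rightarrow> real) \<Rightarrow> 'a \<Rightarrow> real" where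
  "grad_inner f h p = grad_inner_chart (chart_at A p) f h (snd (chart_at A p) p)"

lemma grad_inner_eq_chart:
  assumes "C1 f" "C1 h" "c \<in> A" "p \<in> fst c"
  shows "grad_inner f h p = grad_inner_chart c f h (snd c p)"
proof -
  have "snd c p \<in> overlap c (chart_at A p)" by (intro imageI IntI assms(4) chart_at_in)
  then show ?thesis
    unfolding grad_inner_def
    using grad_inner_chart_transition[OF assms(1,2,3) chart_at_in(1), of "snd c p"]
    by (simp add: transition_def chart_inv_chart[OF assms(3,4)])
qed

lemma continuous_grad_inner:
  assumes "C1 f" "C1 h"
  shows "continuous_on UNIV (grad_inner f h)"
proof (rule continuous_local)
  fix c assume c: "c \<in> A"
  have "continuous_on (fst c) (\<lambda>p. grad_inner_chart c f h (snd c p))"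
    by (rule continuous_on_compose2[OF continuous_on_grad_inner_chart[OF assms c] continuous_chart[OF c]])
      (auto simp: chart_in[OF c])
  then show "continuous_on (fst c) (grad_inner f h)"
    by (rule continuous_on_eq) (simp add: grad_inner_eq_chart[OF assms c])
qed

lemma grad_norm_square: "(grad_norm A g f p)\<^sup>2 = grad_inner f f p"
proof -
  let ?c = "chart_at A p"
  have x: "snd ?c p \<in> coord_dom ?c" by (rule chart_in[OF chart_at_in])
  show ?thesis
    unfolding grad_norm_def Let_def metric_norm_def grad_inner_def
      grad_inner_chart_eq_metric[OF chart_at_in(1) x]
    by (rule real_sqrt_pow2[OF metric_nonneg[OF chart_at_in(1) x]])
qed

section \<open>Existence and uniqueness of the Riemannian volume\<close>

text \<open>
The candidate for the restriction of the Riemannian volume to the domain of \<open>c\<close>.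
\<close>

definition chart_measure :: "('a, 'n) chart \<Rightarrow> 'a measure" where
  "chart_measure c =
     distr (density (restrict_space lborel (coord_dom c)) (\<lambda>x. ennreal (vol c x))) borel (chart_inv c)"

lemma sets_chart_measure [simp, measurable_cong]: "sets (chart_measure c) = sets borel"
  by (simp add: chart_measure_def)

lemma coord_dom_borel: "c \<in> A \<Longrightarrow> coord_dom c \<in> sets borel"
  using open_coord_dom by simp

lemma measurable_on_coord_dom:
  fixes f :: "real ^ 'n \<Rightarrow> 'b::topological_space"
  assumes "continuous_on (coord_dom c) f"
  shows "f \<in> borel_measurable (restrict_space lborel (coord_dom c))"
proof -
  have "sets (restrict_space lborel (coord_dom c)) = sets (restrict_space borel (coord_dom c))"
    by (rule sets_restrict_space_cong) simp
  then show ?thesis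
    using borel_measurable_continuous_on_restrict[OF assms] by (simp cong: measurable_cong_sets)
qed

lemma measurable_vol: "c \<in> A \<Longrightarrow> vol c \<in> borel_measurable (restrict_space lborel (coord_dom c))"
  by (intro measurable_on_coord_dom C1_on_imp_continuous_on C1_on_vol)

lemma measurable_chart_inv:
  "c \<in> A \<Longrightarrow> chart_inv c \<in> borel_measurable (restrict_space lborel (coord_dom c))"
  by (intro measurable_on_coord_dom continuous_chart_inv)

lemma chart_image_borel:
  assumes c: "c \<in> A" and B: "B \<in> sets borel" "B \<subseteq> fst c"
  shows "snd c ` B \<in> sets borel"
proof -
  have "chart_inv c -` B \<inter> space (restrict_space lborel (coord_dom c))
      \<in> sets (restrict_space lborel (coord_dom c))"
    by (rule measurable_sets[OF measurable_chart_inv[OF c] B(1)])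
  then have "chart_inv c -` B \<inter> coord_dom c \<in> sets borel"
    using coord_dom_borel[OF c] by (simp add: space_restrict_space sets_restrict_space_iff)
  moreover have "chart_inv c -` B \<inter> coord_dom c = snd c ` B"
  proof
    show "chart_inv c -` B \<inter> coord_dom c \<subseteq> snd c ` B"
      using chart_chart_inv[OF c] by force
    show "snd c ` B \<subseteq> chart_inv c -` B \<inter> coord_dom c"
      using B(2) chart_inv_chart[OF c] chart_in[OF c] by auto
  qed
  ultimately show ?thesis by simp
qed

lemma emeasure_chart_measure:
  assumes c: "c \<in> A" and B: "B \<in> sets borel"
  shows "emeasure (chart_measure c) B =
    (\<integral>\<^sup>+x. ennreal (vol c x) * indicator (snd c ` (B \<inter> fst c)) x \<partial>lborel)"
proof -
  let ?R = "restrict_space lborel (coord_dom c)"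
  have meas: "chart_inv c \<in> borel_measurable (density ?R (\<lambda>x. ennreal (vol c x)))"
    using measurable_chart_inv[OF c] by (simp cong: measurable_cong_sets)
  have pre: "chart_inv c -` B \<inter> space ?R \<in> sets ?R"
    by (rule measurable_sets[OF measurable_chart_inv[OF c] B])
  have "emeasure (chart_measure c) B =
      emeasure (density ?R (\<lambda>x. ennreal (vol c x))) (chart_inv c -` B \<inter> space ?R)"
    unfolding chart_measure_def by (simp add: emeasure_distr[OF meas B])
  also have "\<dots> = (\<integral>\<^sup>+x. ennreal (vol c x) * indicator (chart_inv c -` B \<inter> space ?R) x \<partial>?R)"
    by (intro emeasure_density pre measurable_compose[OF measurable_vol[OF c] measurable_ennreal])
  also have "\<dots> = (\<integral>\<^sup>+x. ennreal (vol c x) * indicator (chart_inv c -` B \<inter> space ?R) x *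
      indicator (coord_dom c) x \<partial>lborel)"
    using coord_dom_borel[OF c] by (intro nn_integral_restrict_space) simp
  also have "\<dots> = (\<integral>\<^sup>+x. ennreal (vol c x) * indicator (snd c ` (B \<inter> fst c)) x \<partial>lborel)"
  proof (rule nn_integral_cong)
    fix x
    have "x \<in> chart_inv c -` B \<and> x \<in> coord_dom c \<longleftrightarrow> x \<in> snd c ` (B \<inter> fst c)"
    proof
      assume "x \<in> chart_inv c -` B \<and> x \<in> coord_dom c"
      then show "x \<in> snd c ` (B \<inter> fst c)"
        using chart_chart_inv[OF c, of x] chart_inv_in[OF c, of x]
        by (intro image_eqI[of _ _ "chart_inv c x"]) auto
    next
      assume "x \<in> snd c ` (B \<inter> fst c)"
      then show "x \<in> chart_inv c -` B \<and> x \<in> coord_dom c"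
        using chart_inv_chart[OF c] chart_in[OF c] by auto
    qed
    then show "ennreal (vol c x) * indicator (chart_inv c -` B \<inter> space ?R) x *
        indicator (coord_dom c) x = ennreal (vol c x) * indicator (snd c ` (B \<inter> fst c)) x"
      by (cases "x \<in> coord_dom c") (auto simp: indicator_def space_restrict_space)
  qed
  finally show ?thesis .
qed

text \<open>
Change of variables under the transition map, whose Jacobian determinant is the quotient of the
two volume densities (\<open>vol_transition\<close>).
\<close>

lemma emeasure_chart_measure_overlap:
  assumes cd: "c \<in> A" "d \<in> A" and B: "B \<in> sets borel" "B \<subseteq> fst c" "B \<subseteq> fst d"
  shows "emeasure (chart_measure c) B = emeasure (chart_measure d) B"
proof -
  let ?\<tau> = "transition c d" and ?S = "snd c ` B"
  have S: "x \<in> overlap c d" "x \<in> coord_dom c" if "x \<in> ?S" for x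
    using that B chart_in[OF cd(1)] by auto
  have im: "?\<tau> ` ?S = snd d ` B"
    using B(2) by (auto simp: transition_def chart_inv_chart[OF cd(1)] image_image subset_eq
        intro!: image_cong)
  have inj: "inj_on ?\<tau> ?S"
    by (rule inj_on_inverseI[of _ "snd c \<circ> chart_inv d"])
      (use S in \<open>simp add: transition_overlap(2)[OF cd] chart_chart_inv[OF cd(1)]\<close>)
  have vol_S: "\<bar>det (jac c d x)\<bar> * \<bar>vol d (?\<tau> x)\<bar> = vol c x" if "x \<in> ?S" for x
    using vol_transition[OF cd S(1)[OF that]] vol_pos[OF cd(2) transition_overlap(1)[OF cd S(1)[OF that]]]
    by simp
  have meas: "(\<lambda>x. indicator (snd e ` B) x * \<bar>vol e x\<bar>) \<in> borel_measurable borel"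
    if e: "e \<in> A" "B \<subseteq> fst e" for e
  proof -
    have "snd e ` B \<subseteq> coord_dom e" using e(2) chart_in[OF e(1)] by blast
    then have "continuous_on (snd e ` B) (\<lambda>x. \<bar>vol e x\<bar>)"
      by (intro continuous_intros continuous_on_subset[OF C1_on_imp_continuous_on[OF C1_on_vol[OF e(1)]]])
    from borel_measurable_continuous_on_indicator[OF chart_image_borel[OF e(1) B(1) e(2)] this]
    show ?thesis by simp
  qed
  have abs_vol: "\<bar>vol e x\<bar> = vol e x" if "x \<in> snd e ` B" "e \<in> A" "B \<subseteq> fst e" for e x
    using that vol_pos[of e x] chart_in[of e] by fastforce
  have eq: "(\<lambda>x. indicator ?S x * (\<bar>det (jac c d x)\<bar> * \<bar>vol d (?\<tau> x)\<bar>)) =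
      (\<lambda>x. indicator ?S x * \<bar>vol c x\<bar>)"
    using vol_S abs_vol[OF _ cd(1) B(2)] by (auto simp: fun_eq_iff indicator_def)
  have chart_ind: "emeasure (chart_measure e) B =
      (\<integral>\<^sup>+x. ennreal (indicator (snd e ` B) x * \<bar>vol e x\<bar>) \<partial>lborel)"
    if e: "e \<in> A" "B \<subseteq> fst e" for e
  proof -
    have "B \<inter> fst e = B" using e(2) by blast
    then show ?thesis
      unfolding emeasure_chart_measure[OF e(1) B(1)]
      using abs_vol[OF _ e] by (intro nn_integral_cong) (simp add: indicator_def)
  qed
  have matrix_jac: "matrix ((*v) (jac c d x)) = jac c d x" for x
    by simp
  have "emeasure (chart_measure d) B =
      (\<integral>\<^sup>+y. ennreal (indicator (?\<tau> ` ?S) y * \<bar>vol d y\<bar>) \<partial>lborel)"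
    by (simp add: im chart_ind[OF cd(2) B(3)])
  also have "\<dots> = (\<integral>\<^sup>+x. ennreal (indicator ?S x *
      (\<bar>det (matrix ((*v) (jac c d x)))\<bar> * \<bar>vol d (?\<tau> x)\<bar>)) \<partial>lborel)"
  proof (rule nn_integral_change_of_variables)
    show "?S \<in> sets borel" by (rule chart_image_borel[OF cd(1) B(1,2)])
    show "(?\<tau> has_derivative (*v) (jac c d x)) (at x within ?S)" if "x \<in> ?S" for x
      by (rule has_derivative_at_withinI[OF transition_has_derivative[OF cd S(1)[OF that]]])
    show "(\<lambda>y. indicat_real (?\<tau> ` ?S) y * \<bar>vol d y\<bar>) \<in> borel_measurable borel"
      unfolding im by (rule meas[OF cd(2) B(3)])
    show "(\<lambda>x. indicat_real ?S x * (\<bar>det (matrix ((*v) (jac c d x)))\<bar> * \<bar>vol d (?\<tau> x)\<bar>))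
        \<in> borel_measurable borel"
      unfolding matrix_jac eq by (rule meas[OF cd(1) B(2)])
  qed (use inj in auto)
  also have "\<dots> = emeasure (chart_measure c) B"
    unfolding matrix_jac chart_ind[OF cd(1) B(2)] fun_cong[OF eq] ..
  finally show ?thesis by simp
qed

text \<open>
By second countability, countably many chart domains cover the manifold; each is reduced by the
ones before it.
\<close>

lemma countable_chart_partition:
  obtains cs :: "nat \<Rightarrow> ('a, 'n) chart" and D :: "nat \<Rightarrow> 'a set"
  where "\<And>k. cs k \<in> A" "\<And>k. D k \<subseteq> fst (cs k)" "\<And>k. D k \<in> sets borel"
    "disjoint_family D" "(\<Union>k. D k) = UNIV"
proof -
  have "open S" if "S \<in> fst ` A" for S
    using that open_chart by auto
  from Lindelof[OF this] obtain F
    where F: "F \<subseteq> fst ` A" "countable F" "\<Union>F = \<Union>(fst ` A)" .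
  then have "\<exists>C. countable C \<and> C \<subseteq> A \<and> F = fst ` C"
    unfolding countable_subset_image[symmetric] by blast
  then obtain C where C: "C \<subseteq> A" "countable C" "F = fst ` C" by blast
  have cover: "(\<Union>c\<in>C. fst c) = UNIV"
    using F(3) C(3) atlas unfolding smooth_atlas_def by simp
  have "C \<noteq> {}"
  proof
    assume "C = {}"
    then show False using cover by simp
  qed
  then have range: "range (from_nat_into C) = C"
    using C(2) by simp
  define U where "U k = fst (from_nat_into C k)" for k
  show thesis
  proof (rule that[of "from_nat_into C" "disjointed U"])
    show in_A: "from_nat_into C k \<in> A" for k
      by (rule subsetD[OF C(1) from_nat_into[OF \<open>C \<noteq> {}\<close>]])
    have "range U \<subseteq> sets borel"
      using open_chart[OF in_A] by (auto simp: U_def)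
    from sets.range_disjointed_sets[OF this] show "disjointed U k \<in> sets borel" for k
      by (rule subsetD) (rule rangeI)
    show "disjointed U k \<subseteq> fst (from_nat_into C k)" for k
      using disjointed_subset[of U k] by (simp add: U_def)
    show "disjoint_family (disjointed U)" by (rule disjoint_family_disjointed)
    have "(\<Union>k. U k) = (\<Union>c\<in>range (from_nat_into C). fst c)"
      unfolding U_def by simp
    then show "(\<Union>k. disjointed U k) = UNIV"
      unfolding UN_disjointed_eq range cover .
  qed
qed

lemma emeasure_partition:
  assumes V: "sets V = sets borel"
    and D: "\<And>k :: nat. D k \<in> sets borel" "disjoint_family D" "(\<Union>k. D k) = UNIV"
    and B: "B \<in> sets borel"
  shows "emeasure V B = (\<Sum>k. emeasure V (B \<inter> D k))"
proof -
  have "(\<Sum>k. emeasure V (B \<inter> D k)) = emeasure V (\<Union>k. B \<inter> D k)"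
    using D B V by (intro suminf_emeasure) (auto simp: disjoint_family_on_def)
  also have "(\<Union>k. B \<inter> D k) = B" using D(3) by auto
  finally show ?thesis by simp
qed

text \<open>
The property that singles out \<open>riemannian_volume\<close>.
\<close>

definition is_volume :: "'a measure \<Rightarrow> bool" where
  "is_volume V \<longleftrightarrow> sets V = sets borel \<and> (\<forall>c\<in>A. \<forall>B\<in>sets borel. B \<subseteq> fst c \<longrightarrow>
     emeasure V B = (\<integral>\<^sup>+ x\<in>snd c ` B. ennreal (sqrt (det (g c x))) \<partial>lborel))"

lemma is_volume_iff:
  "is_volume V \<longleftrightarrow> sets V = sets borel \<and> (\<forall>c\<in>A. \<forall>B\<in>sets borel. B \<subseteq> fst c \<longrightarrow>
     emeasure V B = emeasure (chart_measure c) B)"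
  unfolding is_volume_def by (auto simp: emeasure_chart_measure vol_def Int_absorb2)

text \<open>
The chart measures are glued along a countable partition into pieces of chart domains; they agree on
overlaps, so the result does not depend on which chart measures a given piece.
\<close>

lemma ex_volume: "\<exists>V. is_volume V"
proof -
  obtain cs D where cs: "\<And>k :: nat. cs k \<in> A"
    and D: "\<And>k. D k \<subseteq> fst (cs k)" "\<And>k. D k \<in> sets borel" "disjoint_family D" "(\<Union>k. D k) = UNIV"
    using countable_chart_partition by blast
  define \<mu> where "\<mu> B = (\<integral>\<^sup>+k. emeasure (chart_measure (cs k)) (B \<inter> D k) \<partial>count_space UNIV)" for B
  define V where "V = measure_of UNIV (sets borel) \<mu>"
  have sets_V: "sets V = sets borel"
    unfolding V_def using sets.sigma_sets_eq[of "borel :: 'a measure"] by simp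
  have ca: "countably_additive (sets borel) \<mu>"
  proof (rule countably_additiveI)
    fix F :: "nat \<Rightarrow> 'a set"
    assume F: "range F \<subseteq> sets borel" "disjoint_family F" "\<Union>(range F) \<in> sets borel"
    have "(\<Sum>i. \<mu> (F i)) =
        (\<integral>\<^sup>+k. (\<Sum>i. emeasure (chart_measure (cs k)) (F i \<inter> D k)) \<partial>count_space UNIV)"
      unfolding \<mu>_def by (rule nn_integral_suminf[symmetric]) simp
    also have "\<dots> = (\<integral>\<^sup>+k. emeasure (chart_measure (cs k)) (\<Union>i. F i \<inter> D k) \<partial>count_space UNIV)"
      using F D by (intro nn_integral_cong suminf_emeasure) (auto simp: disjoint_family_on_def)
    also have "\<dots> = \<mu> (\<Union>i. F i)" unfolding \<mu>_def by simp
    finally show "(\<Sum>i. \<mu> (F i)) = \<mu> (\<Union>i. F i)" .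
  qed
  have "sigma_algebra UNIV (sets (borel :: 'a measure))"
    using sets.sigma_algebra_axioms[of "borel :: 'a measure"] by simp
  moreover have "positive (sets borel) \<mu>" by (simp add: positive_def \<mu>_def)
  ultimately have em: "emeasure V B = \<mu> B" if "B \<in> sets borel" for B
    unfolding V_def by (intro emeasure_measure_of_sigma ca that)
  have "emeasure V B = emeasure (chart_measure c) B"
    if c: "c \<in> A" and B: "B \<in> sets borel" "B \<subseteq> fst c" for c B
  proof -
    have "emeasure V B = (\<Sum>k. emeasure (chart_measure (cs k)) (B \<inter> D k))"
      unfolding em[OF B(1)] \<mu>_def by (rule nn_integral_count_space_nat)
    also have "\<dots> = (\<Sum>k. emeasure (chart_measure c) (B \<inter> D k))"
    proof (rule suminf_cong)
      show "emeasure (chart_measure (cs k)) (B \<inter> D k) = emeasure (chart_measure c) (B \<inter> D k)" for k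
        using B D(1,2)[of k] by (intro emeasure_chart_measure_overlap[OF cs c]) auto
    qed
    also have "\<dots> = emeasure (chart_measure c) B"
      by (rule emeasure_partition[OF sets_chart_measure D(2,3,4) B(1), symmetric])
    finally show ?thesis .
  qed
  then show ?thesis unfolding is_volume_iff using sets_V by blast
qed

lemma volume_unique:
  assumes V: "is_volume V" and W: "is_volume W"
  shows "V = W"
proof (rule measure_eqI)
  obtain cs D where cs: "\<And>k :: nat. cs k \<in> A"
    and D: "\<And>k. D k \<subseteq> fst (cs k)" "\<And>k. D k \<in> sets borel" "disjoint_family D" "(\<Union>k. D k) = UNIV"
    using countable_chart_partition by blast
  show "sets V = sets W" using V W by (simp add: is_volume_def)
  fix B assume "B \<in> sets V"
  then have B: "B \<in> sets borel" using V by (simp add: is_volume_def)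
  have "emeasure V (B \<inter> D k) = emeasure W (B \<inter> D k)" for k
  proof -
    have "B \<inter> D k \<in> sets borel" "B \<inter> D k \<subseteq> fst (cs k)" using B D(1,2)[of k] by auto
    then show ?thesis
      using V W cs[of k] unfolding is_volume_iff by simp
  qed
  moreover have "sets V = sets borel" "sets W = sets borel" using V W by (simp_all add: is_volume_def)
  ultimately show "emeasure V B = emeasure W B"
    by (simp add: emeasure_partition[OF _ D(2,3,4) B])
qed

abbreviation "dV \<equiv> riemannian_volume A g"

lemma volume: "is_volume dV"
proof -
  obtain V where V: "is_volume V" using ex_volume by blast
  have "\<exists>!V. is_volume V" by (rule ex1I[of is_volume, OF V]) (rule volume_unique[OF _ V])
  from theI'[OF this] show ?thesis unfolding riemannian_volume_def is_volume_def .
qed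

lemma sets_volume [simp, measurable_cong]: "sets dV = sets borel"
  using volume by (simp add: is_volume_def)

lemma space_volume [simp]: "space dV = UNIV"
  using sets_eq_imp_space_eq[OF sets_volume] by simp

lemma emeasure_volume:
  "c \<in> A \<Longrightarrow> B \<in> sets borel \<Longrightarrow> B \<subseteq> fst c \<Longrightarrow> emeasure dV B = emeasure (chart_measure c) B"
  using volume unfolding is_volume_iff by blast

lemma density_volume_chart:
  assumes c: "c \<in> A"
  shows "density dV (indicator (fst c)) = chart_measure c"
proof (rule measure_eqI)
  fix B assume "B \<in> sets (density dV (indicator (fst c)))"
  then have B: "B \<in> sets borel" by simp
  have fc: "fst c \<in> sets borel" using open_chart[OF c] by simp
  have "emeasure (density dV (indicator (fst c))) B = emeasure dV (fst c \<inter> B)"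
    using B fc by (intro emeasure_restricted) simp_all
  also have "\<dots> = emeasure (chart_measure c) (fst c \<inter> B)"
    using B fc by (intro emeasure_volume[OF c]) auto
  also have "\<dots> = emeasure (chart_measure c) B"
    using B fc by (simp add: emeasure_chart_measure[OF c] Int_ac)
  finally show "emeasure (density dV (indicator (fst c))) B = emeasure (chart_measure c) B" .
qed simp

text \<open>
The density of the volume with respect to the domain of \<open>c\<close> is the chart measure, which is by
construction the image of a density with respect to the Lebesgue measure.
\<close>

lemma integral_volume_chart:
  assumes c: "c \<in> A" and f: "f \<in> borel_measurable borel" "\<And>p. p \<notin> fst c \<Longrightarrow> f p = (0::real)"
  shows "(LINT p|dV. f p) = (LINT x|lborel. indicator (coord_dom c) x * (vol c x * f (chart_inv c x)))"
proof -
  let ?R = "restrict_space lborel (coord_dom c)"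
  have fc: "fst c \<in> sets borel" using open_chart[OF c] by simp
  have meas: "chart_inv c \<in> borel_measurable (density ?R (\<lambda>x. ennreal (vol c x)))"
    using measurable_chart_inv[OF c] by (simp cong: measurable_cong_sets)
  have f': "(\<lambda>x. f (chart_inv c x)) \<in> borel_measurable ?R"
    by (rule measurable_compose[OF measurable_chart_inv[OF c] f(1)])
  have nonneg: "AE x in ?R. 0 \<le> vol c x"
    using vol_pos[OF c] by (intro AE_I2) (auto simp: space_restrict_space less_imp_le)
  have "(LINT p|dV. f p) = (LINT p|dV. indicator (fst c) p *\<^sub>R f p)"
    using f(2) by (intro Bochner_Integration.integral_cong) (auto simp: indicator_def)
  also have "\<dots> = (LINT p|density dV (\<lambda>p. ennreal (indicator (fst c) p)). f p)"
    using f(1) fc by (intro integral_density[symmetric]) (auto simp: measurable_cong_sets[OF sets_volume refl])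
  also have "density dV (\<lambda>p. ennreal (indicator (fst c) p)) = chart_measure c"
    using density_volume_chart[OF c] by (simp add: ennreal_indicator)
  also have "(LINT p|chart_measure c. f p) =
      (LINT x|density ?R (\<lambda>x. ennreal (vol c x)). f (chart_inv c x))"
    unfolding chart_measure_def by (rule integral_distr[OF meas f(1)])
  also have "\<dots> = (LINT x|?R. vol c x *\<^sub>R f (chart_inv c x))"
    by (rule integral_density[OF f' measurable_vol[OF c] nonneg])
  also have "\<dots> = (LINT x|lborel. indicator (coord_dom c) x *\<^sub>R (vol c x *\<^sub>R f (chart_inv c x)))"
    using coord_dom_borel[OF c] by (intro integral_restrict_space) simp
  finally show ?thesis by simp
qed

lemma ex_finite_volume_neighbourhood:
  "\<exists>N. open N \<and> p \<in> N \<and> emeasure dV N < \<infinity>"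
proof -
  define c where "c = chart_at A p"
  have c: "c \<in> A" "p \<in> fst c" unfolding c_def by (rule chart_at_in)+
  obtain r where r: "0 < r" "cball (snd c p) r \<subseteq> coord_dom c"
    using open_contains_cball open_coord_dom[OF c(1)] chart_in[OF c] by blast
  let ?b = "ball (snd c p) r" and ?N = "chart_inv c ` ball (snd c p) r"
  have sub: "?b \<subseteq> coord_dom c" using r(2) ball_subset_cball by blast
  have N: "open ?N" by (rule open_chart_inv_image[OF c(1) _ sub]) simp
  have img: "snd c ` (?N \<inter> fst c) = ?b"
  proof -
    have "?N \<inter> fst c = ?N" using sub chart_inv_in[OF c(1)] by blast
    moreover have "snd c ` ?N = ?b"
      using sub chart_chart_inv[OF c(1)] by (force simp: image_image)
    ultimately show ?thesis by simp
  qed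
  have "bounded (vol c ` cball (snd c p) r)"
    by (intro compact_imp_bounded compact_continuous_image compact_cball
        continuous_on_subset[OF C1_on_imp_continuous_on[OF C1_on_vol[OF c(1)]] r(2)])
  then obtain M where "\<forall>x\<in>cball (snd c p) r. \<bar>vol c x\<bar> \<le> M"
    unfolding bounded_iff by auto
  then have M: "vol c x \<le> M" if "x \<in> cball (snd c p) r" for x
    using that abs_le_D1 by blast
  have "emeasure dV ?N = emeasure (chart_measure c) ?N"
    using N sub chart_inv_in[OF c(1)] by (intro emeasure_volume[OF c(1)]) auto
  also have "\<dots> = (\<integral>\<^sup>+x. ennreal (vol c x) * indicator ?b x \<partial>lborel)"
    using N by (subst emeasure_chart_measure[OF c(1)]) (auto simp: img)
  also have "\<dots> \<le> (\<integral>\<^sup>+x. ennreal M * indicator ?b x \<partial>lborel)"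
  proof (rule nn_integral_mono)
    show "ennreal (vol c x) * indicator ?b x \<le> ennreal M * indicator ?b x" for x
      using M[of x] by (cases "x \<in> ?b") (auto intro!: ennreal_leI)
  qed
  also have "\<dots> = ennreal M * emeasure lborel ?b"
    by (rule nn_integral_cmult_indicator) simp
  also have "\<dots> < \<infinity>"
    using emeasure_bounded_finite[of ?b] by (simp add: ennreal_mult_less_top)
  finally have "emeasure dV ?N < \<infinity>" .
  moreover have "p \<in> ?N"
    using r(1) chart_inv_chart[OF c] by (intro image_eqI[of _ _ "snd c p"]) simp_all
  ultimately show ?thesis using N by blast
qed

lemma compact_finite_volume:
  assumes K: "compact K"
  shows "emeasure dV K < \<infinity>"
proof -
  have "\<forall>p. \<exists>N. open N \<and> p \<in> N \<and> emeasure dV N < \<infinity>"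
    using ex_finite_volume_neighbourhood by blast
  from choice[OF this] obtain N where
    "\<forall>p. open (N p) \<and> p \<in> N p \<and> emeasure dV (N p) < \<infinity>" ..
  then have N: "open (N p)" "p \<in> N p" "emeasure dV (N p) < \<infinity>" for p
    by simp_all
  have "K \<subseteq> (\<Union>p\<in>K. N p)" using N(2) by blast
  from compactE_image[OF K N(1) this] obtain T where T: "finite T" "K \<subseteq> (\<Union>p\<in>T. N p)"
    by metis
  have "open (\<Union>p\<in>T. N p)" using N(1) by blast
  then have "emeasure dV K \<le> emeasure dV (\<Union>p\<in>T. N p)"
    using T(2) by (intro emeasure_mono) simp_all
  also have "\<dots> \<le> (\<Sum>p\<in>T. emeasure dV (N p))"
    using N(1) T(1) by (intro emeasure_subadditive_finite) auto
  also have "\<dots> < \<infinity>"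
    using N(3) T(1) by (simp add: less_top[symmetric])
  finally show ?thesis .
qed

text \<open>
A continuous function is bounded on a compact set, and compact sets have finite volume.
\<close>

lemma integrable_volume:
  fixes f :: "'a \<Rightarrow> real"
  assumes f: "continuous_on UNIV f" and K: "compact K" "\<And>p. p \<notin> K \<Longrightarrow> f p = 0"
  shows "integrable dV f"
proof -
  have "bounded (f ` K)"
    by (intro compact_imp_bounded compact_continuous_image K continuous_on_subset[OF f]) auto
  then obtain M where M: "\<And>p. p \<in> K \<Longrightarrow> norm (f p) \<le> M"
    by (auto simp: bounded_iff)
  show ?thesis
  proof (rule integrableI_bounded_set[where A = K and B = M])
    show "K \<in> sets dV" using compact_imp_closed[OF K(1)] by simp
    show "f \<in> borel_measurable dV"
      using borel_measurable_continuous_onI[OF f] by (simp add: measurable_cong_sets[OF sets_volume refl])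
    show "emeasure dV K < \<infinity>" by (rule compact_finite_volume[OF K(1)])
    show "AE p in dV. p \<in> K \<longrightarrow> norm (f p) \<le> M" using M by simp
    show "AE p in dV. p \<notin> K \<longrightarrow> f p = 0" using K(2) by simp
  qed
qed

section \<open>Green's formula in a chart\<close>

lemma C1_mult: "C1 f \<Longrightarrow> C1 h \<Longrightarrow> C1 (\<lambda>p. f p * h p)"
  using C1_on_mult[OF C1_chart C1_chart] by (intro C1I) (simp add: comp_def)

lemma C1_sum: "(\<And>i. i \<in> I \<Longrightarrow> C1 (f i)) \<Longrightarrow> C1 (\<lambda>p. \<Sum>i\<in>I. f i p)"
  unfolding C1_def Ck_manifold_def C1_on_def[symmetric] comp_def by (intro ballI C1_on_sum) blast

lemma C1_on_coord_dom_cover: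
  assumes c: "c \<in> A" and VW: "open V" "open W" "V \<union> W = UNIV"
    and f: "C1_on (snd c ` (fst c \<inter> V)) (f \<circ> chart_inv c)" "C1_on (snd c ` (fst c \<inter> W)) (f \<circ> chart_inv c)"
  shows "C1_on (coord_dom c) (f \<circ> chart_inv c)"
proof -
  have "C1_on (snd c ` (fst c \<inter> V) \<union> snd c ` (fst c \<inter> W)) (f \<circ> chart_inv c)"
    by (intro C1_on_Un open_chart_image c VW f)
  also have "snd c ` (fst c \<inter> V) \<union> snd c ` (fst c \<inter> W) = coord_dom c"
    using VW(3) by (auto simp: coord_dom_def)
  finally show ?thesis .
qed

lemma C1_on_chart_zero:
  assumes c: "c \<in> A" and W: "open W" and f: "\<And>q. q \<in> W \<Longrightarrow> f q = 0"
  shows "C1_on (snd c ` (fst c \<inter> W)) (f \<circ> chart_inv c)"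
  by (rule C1_on_cong[OF open_chart_image[OF c W] _ C1_on_const[of _ 0]])
    (auto simp: chart_inv_chart[OF c] f)

text \<open>
Where \<open>h\<close> vanishes the quotient is zero, and every such point has the neighbourhood \<open>- K\<close>, on which
the quotient is zero too.
\<close>

lemma C1_divide:
  assumes f: "C1 f" "C1 h" and K: "closed K" "\<And>p. p \<notin> K \<Longrightarrow> f p = 0" "\<And>p. p \<in> K \<Longrightarrow> h p \<noteq> 0"
  shows "C1 (\<lambda>p. f p / h p)"
proof (rule C1I)
  fix c assume c: "c \<in> A"
  have open_h: "open {p. h p \<noteq> 0}"
    by (rule open_Collect_neq[OF C1_continuous[OF f(2)]]) (rule continuous_on_const)
  show "C1_on (coord_dom c) ((\<lambda>p. f p / h p) \<circ> chart_inv c)"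
  proof (rule C1_on_coord_dom_cover[OF c open_h open_Compl[OF K(1)]])
    show "{p. h p \<noteq> 0} \<union> - K = UNIV" using K(3) by auto
    have sub: "snd c ` (fst c \<inter> {p. h p \<noteq> 0}) \<subseteq> coord_dom c" by (auto simp: coord_dom_def)
    have "C1_on (snd c ` (fst c \<inter> {p. h p \<noteq> 0})) (\<lambda>x. (f \<circ> chart_inv c) x / (h \<circ> chart_inv c) x)"
      by (intro C1_on_divide C1_on_subset[OF C1_chart[OF _ c] sub] f)
        (auto simp: chart_inv_chart[OF c])
    then show "C1_on (snd c ` (fst c \<inter> {p. h p \<noteq> 0})) ((\<lambda>p. f p / h p) \<circ> chart_inv c)"
      by (simp add: comp_def)
    show "C1_on (snd c ` (fst c \<inter> - K)) ((\<lambda>p. f p / h p) \<circ> chart_inv c)"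
      by (rule C1_on_chart_zero[OF c]) (simp_all add: K open_Compl)
  qed
qed

text \<open>
In coordinates the bump is the square of the positive part of \<open>r\<^sup>2 - |z - x|\<^sup>2\<close>. Extended by zero it is
$C^1$ in every chart \<open>d\<close>: on the overlap with \<open>c\<close> it is composed with a transition map, and off its
support it vanishes.
\<close>

lemma ex_bump:
  assumes c: "c \<in> A" and p: "p \<in> fst c" and W: "open W" "p \<in> W"
  shows "\<exists>b K. C1 b \<and> (\<forall>q. 0 \<le> b q) \<and> 0 < b p \<and> compact K \<and> K \<subseteq> fst c \<inter> W \<and> (\<forall>q. q \<notin> K \<longrightarrow> b q = 0)"
proof -
  let ?x = "snd c p"
  have "?x \<in> snd c ` (fst c \<inter> W)" using p W(2) by blast
  then obtain r where r: "0 < r" "cball ?x r \<subseteq> snd c ` (fst c \<inter> W)"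
    using open_chart_image[OF c W(1)] unfolding open_contains_cball by blast
  have sub: "cball ?x r \<subseteq> coord_dom c" using r(2) by (auto simp: coord_dom_def)
  define K where "K = chart_inv c ` cball ?x r"
  have K: "compact K"
    unfolding K_def
    by (intro compact_continuous_image continuous_on_subset[OF continuous_chart_inv[OF c] sub]) simp
  have K_sub: "K \<subseteq> fst c \<inter> W"
  proof
    fix q assume "q \<in> K"
    then obtain z where z: "z \<in> cball ?x r" "q = chart_inv c z" by (auto simp: K_def)
    then obtain q' where "q' \<in> fst c \<inter> W" "z = snd c q'" using r(2) by blast
    then show "q \<in> fst c \<inter> W" using z(2) chart_inv_chart[OF c] by simp
  qed
  define \<beta> where "\<beta> z = (max 0 (r\<^sup>2 - (z - ?x) \<bullet> (z - ?x)))\<^sup>2" for z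
  have \<beta>: "C1_on UNIV \<beta>"
  proof -
    have "C1_on UNIV (\<lambda>z. r\<^sup>2 - (z - ?x) \<bullet> (z - ?x))"
      by (rule C1_onI[where f' = "\<lambda>z v. - 2 * ((z - ?x) \<bullet> v)"])
        (auto intro!: derivative_eq_intros continuous_intros simp: inner_commute)
    then show ?thesis unfolding \<beta>_def by (rule C1_on_positive_part_square)
  qed
  define b where "b q = (if q \<in> fst c then \<beta> (snd c q) else 0)" for q
  have b0: "b q = 0" if "q \<notin> K" for q
  proof (cases "q \<in> fst c")
    case True
    then have "snd c q \<notin> cball ?x r"
      using that chart_inv_chart[OF c True] unfolding K_def by force
    then have "r < norm (snd c q - ?x)" by (simp add: dist_norm norm_minus_commute)
    then have "r\<^sup>2 \<le> (norm (snd c q - ?x))\<^sup>2" using r(1) by (intro power_mono) auto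
    then show ?thesis
      using True by (simp add: b_def \<beta>_def dot_square_norm)
  qed (simp add: b_def)
  have "C1 b"
  proof (rule C1I)
    fix d assume d: "d \<in> A"
    show "C1_on (coord_dom d) (b \<circ> chart_inv d)"
    proof (rule C1_on_coord_dom_cover[OF d open_chart[OF c] open_Compl[OF compact_imp_closed[OF K]]])
      show "fst c \<union> - K = UNIV" using K_sub by auto
      have "C1_on (overlap d c) (\<lambda>y. \<beta> (transition d c y))"
        by (rule C1_on_compose[OF C1_on_transition[OF d c] \<beta>]) simp
      then show "C1_on (overlap d c) (b \<circ> chart_inv d)"
        by (rule C1_on_cong[OF open_overlap[OF d c], rotated])
          (auto simp: transition_def b_def chart_inv_chart[OF d])
      show "C1_on (snd d ` (fst d \<inter> - K)) (b \<circ> chart_inv d)"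
        by (rule C1_on_chart_zero[OF d]) (simp_all add: b0 compact_imp_closed[OF K] open_Compl)
    qed
  qed
  moreover have "0 \<le> b q" for q by (simp add: b_def \<beta>_def)
  moreover have "0 < b p" using p r(1) by (simp add: b_def \<beta>_def)
  ultimately show ?thesis using K K_sub b0 by blast
qed

lemma continuous_zero_extension:
  fixes h :: "'a \<Rightarrow> real"
  assumes U: "open U" and h: "continuous_on U h" and K: "closed K" "K \<subseteq> U" "\<And>p. p \<notin> K \<Longrightarrow> h p = 0"
  shows "continuous_on UNIV h"
proof -
  have "continuous_on (- K) h"
    by (rule continuous_on_eq[OF continuous_on_const[of _ 0]]) (simp add: K(3))
  then have "continuous_on (U \<union> - K) h" using U K(1) h by (intro continuous_on_open_Un) auto
  moreover have "U \<union> - K = UNIV" using K(2) by auto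
  ultimately show ?thesis by simp
qed

lemma differential_eq_0:
  assumes K: "closed K" "\<And>p. p \<notin> K \<Longrightarrow> f p = 0" and c: "c \<in> A" "p \<in> fst c" and p: "p \<notin> K"
  shows "differential c f (snd c p) = 0"
proof -
  have "partial j (f \<circ> chart_inv c) (snd c p) = partial j (\<lambda>x. 0) (snd c p)" for j
    by (rule partial_cong[OF open_chart_image[OF c(1), of "- K"]])
      (use K c p in \<open>auto simp: chart_inv_chart[OF c(1)]\<close>)
  also have "partial j (\<lambda>x. 0) (snd c p) = (0::real)" for j
    by (simp add: partial_def)
  finally show ?thesis by (simp add: differential_def vec_eq_iff)
qed

lemma grad_inner_eq_0:
  assumes "closed K" "\<And>p. p \<notin> K \<Longrightarrow> f p = 0" "p \<notin> K"
  shows "grad_inner f h p = 0"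
  using differential_eq_0[OF assms(1,2) chart_at_in assms(3)]
  by (simp add: grad_inner_def grad_inner_chart_def)

definition laplace_chart :: "('a, 'n) chart \<Rightarrow> ('a \<Rightarrow> real) \<Rightarrow> real ^ 'n \<Rightarrow> real" where
  "laplace_chart c f x = div_chart g c (grad_chart g c f) x"

definition C2 :: "('a \<Rightarrow> real) \<Rightarrow> bool" where
  "C2 f \<longleftrightarrow> Ck_manifold A (Suc (Suc 0)) f"

lemma C2_imp_C1: "C2 f \<Longrightarrow> C1 f"
  unfolding C2_def Ck_manifold_def by (intro C1I Ck_on_imp_C1_on) blast

lemma C1_on_vol_grad:
  "c \<in> A \<Longrightarrow> C2 f \<Longrightarrow> C1_on (coord_dom c) (\<lambda>x. vol c x * grad_chart g c f x $ i)"
  unfolding C2_def by (intro C1_on_mult C1_on_vol C1_on_grad_chart)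

lemma vol_laplace_chart:
  assumes "c \<in> A" "x \<in> coord_dom c"
  shows "vol c x * laplace_chart c f x =
    (\<Sum>i\<in>UNIV. partial i (\<lambda>y. vol c y * grad_chart g c f y $ i) x)"
  using vol_pos[OF assms] by (simp add: laplace_chart_def div_chart_def vol_def)

lemma continuous_on_laplace_chart:
  assumes c: "c \<in> A" and f: "C2 f"
  shows "continuous_on (fst c) (\<lambda>p. laplace_chart c f (snd c p))"
proof -
  have "continuous_on (coord_dom c)
      (\<lambda>x. (\<Sum>i\<in>UNIV. partial i (\<lambda>y. vol c y * grad_chart g c f y $ i) x) / vol c x)"
    using less_imp_neq[OF vol_pos[OF c], symmetric]
    by (intro continuous_on_divide continuous_on_sum continuous_on_partial C1_on_vol_grad[OF c f]
        C1_on_imp_continuous_on[OF C1_on_vol[OF c]]) blast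
  then have "continuous_on (coord_dom c) (laplace_chart c f)"
    by (simp add: laplace_chart_def[abs_def] div_chart_def vol_def)
  from continuous_on_compose2[OF this continuous_chart[OF c]] show ?thesis
    using chart_in[OF c] by blast
qed

lemma continuous_laplace_times:
  assumes c: "c \<in> A" and f: "C2 f" and \<psi>: "C1 \<psi>"
    and K: "compact K" "K \<subseteq> fst c" "\<And>p. p \<notin> K \<Longrightarrow> \<psi> p = 0"
  shows "continuous_on UNIV (\<lambda>p. laplace_chart c f (snd c p) * \<psi> p)"
proof (rule continuous_zero_extension[OF open_chart[OF c] _ compact_imp_closed[OF K(1)] K(2)])
  show "continuous_on (fst c) (\<lambda>p. laplace_chart c f (snd c p) * \<psi> p)"
    by (intro continuous_intros continuous_on_laplace_chart[OF c f]
        continuous_on_subset[OF C1_continuous[OF \<psi>]]) simp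
qed (simp add: K(3))

text \<open>
The integrand is the divergence of the compactly supported field $\psi\nabla f$, that is,
$(\det g)^{-1/2}\,\partial_i(\sqrt{\det g}\,(\nabla f)^i\,\psi)$. The factor $\sqrt{\det g}$ of the volume
cancels, and what remains are integrals of partial derivatives.
\<close>

lemma green_chart:
  assumes c: "c \<in> A" and f: "C2 f" and \<psi>: "C1 \<psi>"
    and K: "compact K" "K \<subseteq> fst c" "\<And>p. p \<notin> K \<Longrightarrow> \<psi> p = 0"
  shows "(LINT p|dV. laplace_chart c f (snd c p) * \<psi> p + grad_inner \<psi> f p) = 0"
proof -
  let ?U = "coord_dom c" and ?\<psi> = "\<psi> \<circ> chart_inv c"
  let ?X = "\<lambda>i y. vol c y * grad_chart g c f y $ i"
  define F where "F i x = (if x \<in> ?U then ?X i x * ?\<psi> x else 0)" for i x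
  define L where "L = snd c ` K"
  have L: "compact L" "L \<subseteq> ?U"
    unfolding L_def using K(2) chart_in[OF c]
    by (auto intro!: compact_continuous_image K(1) continuous_on_subset[OF continuous_chart[OF c]])
  have \<psi>0: "\<psi> (chart_inv c x) = 0" if "x \<in> ?U" "x \<notin> L" for x
  proof -
    have "chart_inv c x \<notin> K" using that chart_chart_inv[OF c that(1)] unfolding L_def by force
    then show ?thesis by (simp add: K(3))
  qed
  have F: "C1_on UNIV (F i)" for i
    unfolding F_def
    by (rule C1_on_zero_extension[OF C1_on_mult[OF C1_on_vol_grad[OF c f] C1_chart[OF \<psi> c]]
          open_coord_dom[OF c] compact_imp_closed[OF L(1)] L(2)]) (simp add: \<psi>0)
  have F0: "F i x = 0" if "x \<notin> L" for i x
    using that by (simp add: F_def \<psi>0)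
  have partial_outside: "partial i (F i) x = 0" if "x \<notin> L" for i x
  proof -
    have "open (- L)" using compact_imp_closed[OF L(1)] by (rule open_Compl)
    then have "partial i (F i) x = partial i (\<lambda>x. 0) x"
      by (rule partial_cong) (simp_all add: that F0)
    then show ?thesis by (simp add: partial_def)
  qed
  have int_F: "(LINT x|lborel. partial i (F i) x) = 0" for i
    unfolding partial_def by (rule integral_directional_derivative_eq_0[OF F L(1) F0])
  have integrable_F: "integrable lborel (partial i (F i))" for i
    by (rule integrable_continuous_compact_support[OF continuous_on_partial[OF F] L(1) partial_outside])
  have sum_F: "(\<Sum>i\<in>UNIV. partial i (F i) x) = indicator ?U x * (vol c x *
      (laplace_chart c f (snd c (chart_inv c x)) * \<psi> (chart_inv c x) + grad_inner \<psi> f (chart_inv c x)))"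
    for x
  proof (cases "x \<in> ?U")
    case True
    have "partial i (F i) x = ?X i x * partial i ?\<psi> x + partial i (?X i) x * ?\<psi> x" for i
    proof -
      have "partial i (F i) x = partial i (\<lambda>y. ?X i y * ?\<psi> y) x"
        by (rule partial_cong[OF open_coord_dom[OF c] True]) (simp add: F_def)
      also have "\<dots> = ?X i x * partial i ?\<psi> x + partial i (?X i) x * ?\<psi> x"
        by (intro partial_mult C1_on_differentiable[OF C1_on_vol_grad[OF c f] True]
            C1_on_differentiable[OF C1_chart[OF \<psi> c] True])
      finally show ?thesis .
    qed
    then have "(\<Sum>i\<in>UNIV. partial i (F i) x) =
        (\<Sum>i\<in>UNIV. ?X i x * partial i ?\<psi> x) + (\<Sum>i\<in>UNIV. partial i (?X i) x) * ?\<psi> x"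
      by (simp add: sum.distrib sum_distrib_right)
    also have "(\<Sum>i\<in>UNIV. ?X i x * partial i ?\<psi> x) = vol c x * grad_inner_chart c \<psi> f x"
      by (simp add: grad_inner_chart_def inner_vec_def differential_def sum_distrib_left mult_ac)
    also have "(\<Sum>i\<in>UNIV. partial i (?X i) x) = vol c x * laplace_chart c f x"
      by (rule vol_laplace_chart[OF c True, symmetric])
    also have "grad_inner_chart c \<psi> f x = grad_inner \<psi> f (chart_inv c x)"
      using grad_inner_eq_chart[OF \<psi> C2_imp_C1[OF f] c chart_inv_in[OF c True]]
      by (simp add: chart_chart_inv[OF c True])
    finally show ?thesis
      using True by (simp add: chart_chart_inv[OF c True] algebra_simps)
  next
    case False
    then have "x \<notin> L" using L(2) by blast
    then show ?thesis using False by (simp add: partial_outside)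
  qed
  let ?h = "\<lambda>p. laplace_chart c f (snd c p) * \<psi> p + grad_inner \<psi> f p"
  have "?h \<in> borel_measurable borel"
    by (intro borel_measurable_continuous_onI continuous_on_add
        continuous_laplace_times[OF c f \<psi> K] continuous_grad_inner[OF \<psi> C2_imp_C1[OF f]])
  moreover have "?h p = 0" if "p \<notin> fst c" for p
  proof -
    have "p \<notin> K" using K(2) that by blast
    then show ?thesis
      using grad_inner_eq_0[OF compact_imp_closed[OF K(1)] K(3)] by (simp add: K(3))
  qed
  ultimately have "(LINT p|dV. ?h p) = (LINT x|lborel. (\<Sum>i\<in>UNIV. partial i (F i) x))"
    unfolding sum_F by (rule integral_volume_chart[OF c])
  also have "\<dots> = (\<Sum>i\<in>UNIV. LINT x|lborel. partial i (F i) x)"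
    by (rule Bochner_Integration.integral_sum[OF integrable_F])
  finally show ?thesis by (simp add: int_F)
qed

section \<open>Green's formula on the manifold\<close>

text \<open>
In a chart the volume has a positive density with respect to the Lebesgue measure, which does not
annihilate nonempty open sets.
\<close>

lemma emeasure_volume_open_nonzero:
  assumes N: "open N" "p \<in> N"
  shows "emeasure dV N \<noteq> 0"
proof
  assume 0: "emeasure dV N = 0"
  define c where "c = chart_at A p"
  have c: "c \<in> A" "p \<in> fst c" unfolding c_def by (rule chart_at_in)+
  let ?B = "fst c \<inter> N"
  have op: "open (snd c ` ?B)" by (rule open_chart_image[OF c(1) N(1)])
  have B: "?B \<in> sets borel" using N(1) open_chart[OF c(1)] by simp
  have "emeasure dV ?B \<le> emeasure dV N"
    using N(1) by (intro emeasure_mono) auto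
  then have "emeasure (chart_measure c) ?B = 0"
    using emeasure_volume[OF c(1) B] 0 by simp
  then have "(\<integral>\<^sup>+x. ennreal (vol c x) * indicator (snd c ` ?B) x \<partial>lborel) = 0"
    unfolding emeasure_chart_measure[OF c(1) B] by (simp only: Int_assoc Int_absorb Int_left_absorb Int_commute[of N])
  moreover have "(\<lambda>x. ennreal (vol c x) * indicator (snd c ` ?B) x) \<in> borel_measurable lborel"
  proof -
    have "continuous_on (snd c ` ?B) (vol c)"
      by (rule continuous_on_subset[OF C1_on_imp_continuous_on[OF C1_on_vol[OF c(1)]]])
        (auto simp: coord_dom_def)
    with op have "(\<lambda>x. indicator (snd c ` ?B) x *\<^sub>R vol c x) \<in> borel_measurable borel"
      by (intro borel_measurable_continuous_on_indicator) simp_all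
    then have "(\<lambda>x. ennreal (indicator (snd c ` ?B) x *\<^sub>R vol c x)) \<in> borel_measurable lborel"
      by simp
    moreover have "(\<lambda>x. ennreal (indicator (snd c ` ?B) x *\<^sub>R vol c x)) =
        (\<lambda>x. ennreal (vol c x) * indicator (snd c ` ?B) x)"
      by (simp add: fun_eq_iff indicator_def)
    ultimately show ?thesis by simp
  qed
  ultimately have "AE x in lborel. ennreal (vol c x) * indicator (snd c ` ?B) x = 0"
    by (simp add: nn_integral_0_iff_AE)
  moreover have "ennreal (vol c x) * indicator (snd c ` ?B) x = 0 \<longleftrightarrow> x \<notin> snd c ` ?B" for x
  proof (cases "x \<in> snd c ` ?B")
    case True
    then have "x \<in> coord_dom c" by (auto simp: coord_dom_def)
    then have "0 < vol c x" by (rule vol_pos[OF c(1)])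
    then show ?thesis using True by (simp add: ennreal_eq_0_iff not_le)
  qed simp
  ultimately have ae: "AE x in lborel. x \<notin> snd c ` ?B" by simp
  have "snd c ` ?B \<in> null_sets lborel"
    using ae op AE_iff_null_sets[of "snd c ` ?B" lborel] by simp
  then have "negligible (snd c ` ?B)"
    unfolding negligible_iff_null_sets by (rule null_sets_completionI)
  moreover have "snd c ` ?B \<noteq> {}" using c(2) N(2) by blast
  ultimately show False using open_not_negligible[OF op] by blast
qed

lemma integral_volume_pos:
  fixes f :: "'a \<Rightarrow> real"
  assumes f: "continuous_on UNIV f" "\<And>q. 0 \<le> f q" and K: "compact K" "\<And>q. q \<notin> K \<Longrightarrow> f q = 0"
    and p: "0 < f p"
  shows "0 < (LINT q|dV. f q)"
proof -
  have int: "integrable dV f" by (rule integrable_volume[OF f(1) K])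
  have "(LINT q|dV. f q) \<noteq> 0"
  proof
    assume "(LINT q|dV. f q) = 0"
    then have ae: "AE q in dV. f q = 0"
      using integral_nonneg_eq_0_iff_AE[OF int] f(2) by simp
    have op: "open {q. f q \<noteq> 0}"
      by (rule open_Collect_neq[OF f(1)]) (rule continuous_on_const)
    have "{q. f q \<noteq> 0} \<in> null_sets dV"
      using ae op AE_iff_null_sets[of "{q. f q \<noteq> 0}" dV] by simp
    then show False
      using emeasure_volume_open_nonzero[OF op, of p] p by (simp add: null_sets_def)
  qed
  moreover have "0 \<le> (LINT q|dV. f q)" using f(2) by simp
  ultimately show ?thesis by simp
qed

text \<open>
If the Laplacian computed in \<open>c\<close> were larger at \<open>p\<close>, it would be larger on a neighbourhood, and so
would its integral against a bump supported there. But by Green's formula both integrals equal the same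
expression in the gradients. Equality follows by exchanging the two charts.
\<close>

lemma laplace_chart_le:
  assumes f: "C2 f" and cd: "c \<in> A" "d \<in> A" and p: "p \<in> fst c" "p \<in> fst d"
  shows "laplace_chart c f (snd c p) \<le> laplace_chart d f (snd d p)"
proof (rule ccontr)
  let ?c = "\<lambda>q. laplace_chart c f (snd c q)" and ?d = "\<lambda>q. laplace_chart d f (snd d q)"
  assume "\<not> ?c p \<le> ?d p"
  then have pos: "0 < ?c p - ?d p" by simp
  let ?U = "fst c \<inter> fst d"
  have U: "open ?U" using open_chart cd by blast
  have cont: "continuous_on ?U (\<lambda>q. ?c q - ?d q)"
    by (intro continuous_on_diff continuous_on_subset[OF continuous_on_laplace_chart[OF cd(1) f]]
        continuous_on_subset[OF continuous_on_laplace_chart[OF cd(2) f]]) auto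
  define W where "W = ?U \<inter> (\<lambda>q. ?c q - ?d q) -` {0<..}"
  have W: "open W" "p \<in> W"
    unfolding W_def using p pos
    by (auto intro!: continuous_open_preimage[OF cont U])
  obtain b K where b: "C1 b" "\<And>q. 0 \<le> b q" "0 < b p" and K: "compact K" "K \<subseteq> fst c \<inter> W"
    and bK: "\<And>q. q \<notin> K \<Longrightarrow> b q = 0"
    using ex_bump[OF cd(1) p(1) W] by blast
  have Kc: "K \<subseteq> fst c" and Kd: "K \<subseteq> fst d" using K(2) by (auto simp: W_def)
  have cc: "continuous_on UNIV (\<lambda>q. ?c q * b q)" by (rule continuous_laplace_times[OF cd(1) f b(1) K(1) Kc bK])
  have dd: "continuous_on UNIV (\<lambda>q. ?d q * b q)" by (rule continuous_laplace_times[OF cd(2) f b(1) K(1) Kd bK])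
  have gg: "continuous_on UNIV (grad_inner b f)" by (rule continuous_grad_inner[OF b(1) C2_imp_C1[OF f]])
  have g0: "grad_inner b f q = 0" if "q \<notin> K" for q
    by (rule grad_inner_eq_0[OF compact_imp_closed[OF K(1)] bK that])
  have int: "integrable dV (\<lambda>q. ?c q * b q + grad_inner b f q)" "integrable dV (\<lambda>q. ?d q * b q + grad_inner b f q)"
    by (intro integrable_volume[OF _ K(1)] continuous_on_add cc dd gg; simp add: bK g0)+
  have "0 < (LINT q|dV. ?c q * b q - ?d q * b q)"
  proof (rule integral_volume_pos[OF _ _ K(1)])
    show "continuous_on UNIV (\<lambda>q. ?c q * b q - ?d q * b q)" by (intro continuous_on_diff cc dd)
    show "0 \<le> ?c q * b q - ?d q * b q" for q
    proof (cases "q \<in> K")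
      case True
      then have "q \<in> W" using K(2) by blast
      then have "?d q \<le> ?c q" by (simp add: W_def)
      then show ?thesis using b(2) by (simp add: mult_right_mono)
    qed (simp add: bK)
    show "?c q * b q - ?d q * b q = 0" if "q \<notin> K" for q using bK[OF that] by simp
    show "0 < ?c p * b p - ?d p * b p" using pos b(3) by simp
  qed
  also have "(LINT q|dV. ?c q * b q - ?d q * b q) =
      (LINT q|dV. (?c q * b q + grad_inner b f q) - (?d q * b q + grad_inner b f q))"
    by simp
  also have "\<dots> = (LINT q|dV. ?c q * b q + grad_inner b f q) - (LINT q|dV. ?d q * b q + grad_inner b f q)"
    by (rule Bochner_Integration.integral_diff[OF int])
  also have "\<dots> = 0"
    using green_chart[OF cd(1) f b(1) K(1) Kc bK] green_chart[OF cd(2) f b(1) K(1) Kd bK] by simp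
  finally show False by simp
qed

lemma laplace_beltrami_eq_chart:
  assumes "C2 f" "c \<in> A" "p \<in> fst c"
  shows "laplace_beltrami A g f p = laplace_chart c f (snd c p)"
  unfolding laplace_beltrami_def Let_def laplace_chart_def[symmetric]
  by (intro antisym laplace_chart_le assms chart_at_in)

lemma continuous_laplace_beltrami:
  assumes "C2 f"
  shows "continuous_on UNIV (laplace_beltrami A g f)"
proof (rule continuous_local)
  fix c assume c: "c \<in> A"
  show "continuous_on (fst c) (laplace_beltrami A g f)"
    by (rule continuous_on_eq[OF continuous_on_laplace_chart[OF c assms]])
      (simp add: laplace_beltrami_eq_chart[OF assms c])
qed

lemma differential_sum:
  assumes "\<And>i. i \<in> I \<Longrightarrow> C1 (f i)" and c: "c \<in> A" "x \<in> coord_dom c"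
  shows "differential c (\<lambda>p. \<Sum>i\<in>I. f i p) x = (\<Sum>i\<in>I. differential c (f i) x)"
proof -
  have "partial j ((\<lambda>p. \<Sum>i\<in>I. f i p) \<circ> chart_inv c) x = (\<Sum>i\<in>I. partial j (f i \<circ> chart_inv c) x)" for j
  proof -
    have "(((\<lambda>p. \<Sum>i\<in>I. f i p) \<circ> chart_inv c) has_derivative
        (\<lambda>v. \<Sum>i\<in>I. frechet_derivative (f i \<circ> chart_inv c) (at x) v)) (at x)"
      unfolding comp_def
      by (intro has_derivative_sum C1_onD(1)[OF C1_chart[unfolded comp_def] c(2)] assms)
    from partial_eqI[OF this] show ?thesis by (simp add: partial_def)
  qed
  then show ?thesis by (simp add: differential_def vec_eq_iff)
qed

lemma grad_inner_sum:
  assumes "\<And>i. i \<in> I \<Longrightarrow> C1 (f i)"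
  shows "grad_inner (\<lambda>p. \<Sum>i\<in>I. f i p) h p = (\<Sum>i\<in>I. grad_inner (f i) h p)"
  using differential_sum[of I f, OF assms chart_at_in(1) chart_in[OF chart_at_in[of p]]]
  by (simp add: grad_inner_def grad_inner_chart_def inner_sum_left)

text \<open>
The pieces are \<open>b p * \<psi> / s\<close> for finitely many bumps \<open>b p\<close> whose sum \<open>s\<close> is positive on the support of
\<open>\<psi>\<close>.
\<close>

lemma ex_chart_decomposition:
  assumes \<psi>: "C1 \<psi>" and K: "compact K" "\<And>p. p \<notin> K \<Longrightarrow> \<psi> p = 0"
  shows "\<exists>T :: 'a set. \<exists>\<eta> c L. finite T \<and> (\<forall>q. \<psi> q = (\<Sum>p\<in>T. \<eta> p q)) \<and>
    (\<forall>p\<in>T. C1 (\<eta> p) \<and> c p \<in> A \<and> compact (L p) \<and> L p \<subseteq> fst (c p) \<and> (\<forall>q. q \<notin> L p \<longrightarrow> \<eta> p q = 0))"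
proof -
  have "\<forall>p. \<exists>bL. C1 (fst bL) \<and> (\<forall>q. 0 \<le> fst bL q) \<and> 0 < fst bL p \<and> compact (snd bL) \<and>
      snd bL \<subseteq> fst (chart_at A p) \<and> (\<forall>q. q \<notin> snd bL \<longrightarrow> fst bL q = 0)"
    using ex_bump[OF chart_at_in open_UNIV UNIV_I] by simp
  from choice[OF this] obtain bL :: "'a \<Rightarrow> ('a \<Rightarrow> real) \<times> 'a set"
    where bL: "\<forall>p. C1 (fst (bL p)) \<and> (\<forall>q. 0 \<le> fst (bL p) q) \<and> 0 < fst (bL p) p \<and>
      compact (snd (bL p)) \<and> snd (bL p) \<subseteq> fst (chart_at A p) \<and>
      (\<forall>q. q \<notin> snd (bL p) \<longrightarrow> fst (bL p) q = 0)" ..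
  define b L where "b p = fst (bL p)" and "L p = snd (bL p)" for p
  have b: "C1 (b p)" "0 \<le> b p q" "0 < b p p" and L: "compact (L p)" "L p \<subseteq> fst (chart_at A p)"
    and bL0: "q \<notin> L p \<Longrightarrow> b p q = 0" for p q
    using bL by (simp_all add: b_def L_def)
  have op: "open {q. 0 < b p q}" for p
    by (rule open_Collect_less[OF continuous_on_const C1_continuous[OF b(1)]])
  have "K \<subseteq> (\<Union>p\<in>K. {q. 0 < b p q})" using b(3) by blast
  from compactE_image[OF K(1) op this] obtain T
    where T: "finite T" "K \<subseteq> (\<Union>p\<in>T. {q. 0 < b p q})" by metis
  define s where "s q = (\<Sum>p\<in>T. b p q)" for q
  have s: "s q \<noteq> 0" if q: "q \<in> K" for q
  proof -
    obtain p where "p \<in> T" "0 < b p q" using T(2) q by auto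
    then have "0 < s q" unfolding s_def by (intro sum_pos2[OF T(1)] b(2))
    then show ?thesis by simp
  qed
  have C1_s: "C1 s" unfolding s_def by (intro C1_sum b(1))
  define \<eta> where "\<eta> p q = b p q * \<psi> q / s q" for p q
  have "C1 (\<eta> p)" for p
    unfolding \<eta>_def
    by (rule C1_divide[OF C1_mult[OF b(1) \<psi>] C1_s compact_imp_closed[OF K(1)]]) (simp_all add: K(2) s)
  moreover have "\<psi> q = (\<Sum>p\<in>T. \<eta> p q)" for q
  proof (cases "q \<in> K")
    case True
    have "(\<Sum>p\<in>T. \<eta> p q) = s q * \<psi> q / s q"
      by (simp add: \<eta>_def s_def sum_divide_distrib sum_distrib_right)
    then show ?thesis using s[OF True] by simp
  qed (simp add: \<eta>_def K(2))
  moreover have "\<eta> p q = 0" if "q \<notin> L p" for p q by (simp add: \<eta>_def bL0[OF that])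
  ultimately show ?thesis
    using T(1) L chart_at_in(1)
    by (intro exI[of _ T] exI[of _ \<eta>] exI[of _ "chart_at A"] exI[of _ L]) blast
qed

lemma green:
  assumes f: "C2 f" and \<psi>: "C1 \<psi>" and K: "compact K" "\<And>p. p \<notin> K \<Longrightarrow> \<psi> p = 0"
  shows "(LINT p|dV. laplace_beltrami A g f p * \<psi> p + grad_inner \<psi> f p) = 0"
proof -
  obtain T :: "'a set" and \<eta> c L where T: "finite T" "\<forall>q. \<psi> q = (\<Sum>p\<in>T. \<eta> p q)"
    and \<eta>: "\<forall>p\<in>T. C1 (\<eta> p) \<and> c p \<in> A \<and> compact (L p) \<and> L p \<subseteq> fst (c p) \<and>
      (\<forall>q. q \<notin> L p \<longrightarrow> \<eta> p q = 0)"
    using ex_chart_decomposition[OF \<psi> K] by blast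
  let ?h = "\<lambda>p q. laplace_beltrami A g f q * \<eta> p q + grad_inner (\<eta> p) f q"
  have piece: "integrable dV (?h p)" "(LINT q|dV. ?h p q) = 0" if p: "p \<in> T" for p
  proof -
    have C: "C1 (\<eta> p)" "c p \<in> A" and L: "compact (L p)" "L p \<subseteq> fst (c p)"
      and 0: "\<And>q. q \<notin> L p \<Longrightarrow> \<eta> p q = 0"
      using \<eta> p by blast+
    show "integrable dV (?h p)"
    proof (rule integrable_volume[OF _ L(1)])
      show "continuous_on UNIV (?h p)"
        by (intro continuous_on_add continuous_on_mult continuous_laplace_beltrami[OF f]
            C1_continuous[OF C(1)] continuous_grad_inner[OF C(1) C2_imp_C1[OF f]])
      show "?h p q = 0" if "q \<notin> L p" for q
        using grad_inner_eq_0[OF compact_imp_closed[OF L(1)] 0 that] by (simp add: 0[OF that])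
    qed
    have eq: "?h p = (\<lambda>q. laplace_chart (c p) f (snd (c p) q) * \<eta> p q + grad_inner (\<eta> p) f q)"
    proof
      fix q
      show "?h p q = laplace_chart (c p) f (snd (c p) q) * \<eta> p q + grad_inner (\<eta> p) f q"
      proof (cases "q \<in> L p")
        case True
        then have "q \<in> fst (c p)" using L(2) by blast
        then show ?thesis by (simp add: laplace_beltrami_eq_chart[OF f C(2)])
      qed (simp add: 0)
    qed
    show "(LINT q|dV. ?h p q) = 0"
      unfolding eq by (rule green_chart[OF C(2) f C(1) L 0])
  qed
  have C1_\<eta>: "C1 (\<eta> p)" if "p \<in> T" for p using \<eta> that by blast
  have \<psi>_eq: "\<psi> = (\<lambda>q. \<Sum>p\<in>T. \<eta> p q)" using T(2) by (simp add: fun_eq_iff)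
  have "grad_inner \<psi> f q = (\<Sum>p\<in>T. grad_inner (\<eta> p) f q)" for q
    unfolding \<psi>_eq by (rule grad_inner_sum) (rule C1_\<eta>)
  then have "laplace_beltrami A g f q * \<psi> q + grad_inner \<psi> f q = (\<Sum>p\<in>T. ?h p q)" for q
    by (simp add: T(2) sum.distrib sum_distrib_left)
  then have "(LINT q|dV. laplace_beltrami A g f q * \<psi> q + grad_inner \<psi> f q) =
      (LINT q|dV. (\<Sum>p\<in>T. ?h p q))" by simp
  also have "\<dots> = (\<Sum>p\<in>T. LINT q|dV. ?h p q)"
    by (rule Bochner_Integration.integral_sum[OF piece(1)])
  finally show ?thesis by (simp add: piece(2))
qed

text \<open>
With \<open>t = \<phi> / \<zeta>\<close> one has $d(\phi^2/\zeta) = 2t\,d\phi - t^2\,d\zeta$, and the difference of the two sides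
is $|\nabla\phi - t\nabla\zeta|^2 \ge 0$.
\<close>

lemma picone_inequality:
  assumes \<phi>: "C1 \<phi>" and \<zeta>: "C1 \<zeta>" "\<And>p. \<zeta> p \<noteq> 0"
  shows "grad_inner (\<lambda>p. \<phi> p * \<phi> p / \<zeta> p) \<zeta> p \<le> grad_inner \<phi> \<phi> p"
proof -
  let ?\<psi> = "\<lambda>p. \<phi> p * \<phi> p / \<zeta> p"
  define c x where "c = chart_at A p" and "x = snd c p"
  have c: "c \<in> A" "p \<in> fst c" unfolding c_def by (rule chart_at_in)+
  have x: "x \<in> coord_dom c" "chart_inv c x = p"
    unfolding x_def by (rule chart_in[OF c], rule chart_inv_chart[OF c])
  have \<psi>: "C1 ?\<psi>"
    by (rule C1_divide[OF C1_mult[OF \<phi> \<phi>] \<zeta>(1) closed_UNIV]) (simp_all add: \<zeta>(2))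
  define t where "t = \<phi> p / \<zeta> p"
  have diff: "differential c ?\<psi> x = (2 * t) *\<^sub>R differential c \<phi> x - t\<^sup>2 *\<^sub>R differential c \<zeta> x"
  proof -
    have D: "(h \<circ> chart_inv c) differentiable (at x)" if "C1 h" for h
      by (rule C1_on_differentiable[OF C1_chart[OF that c(1)] x(1)])
    have "partial j (?\<psi> \<circ> chart_inv c) x =
        2 * t * partial j (\<phi> \<circ> chart_inv c) x - t\<^sup>2 * partial j (\<zeta> \<circ> chart_inv c) x" for j
    proof -
      let ?a = "partial j (\<phi> \<circ> chart_inv c) x" and ?z = "partial j (\<zeta> \<circ> chart_inv c) x"
        and ?y = "partial j (?\<psi> \<circ> chart_inv c) x"
      \<comment> \<open>Differentiating \<open>\<phi>\<^sup>2 = \<zeta> \<cdot> \<psi>\<close> by the product rule determines the derivative of \<open>\<psi>\<close>.\<close>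
      have "(\<lambda>y. (\<phi> \<circ> chart_inv c) y * (\<phi> \<circ> chart_inv c) y) =
          (\<lambda>y. (\<zeta> \<circ> chart_inv c) y * (?\<psi> \<circ> chart_inv c) y)"
        using \<zeta>(2) by (simp add: fun_eq_iff)
      then have "(\<phi> \<circ> chart_inv c) x * ?a + ?a * (\<phi> \<circ> chart_inv c) x =
          (\<zeta> \<circ> chart_inv c) x * ?y + ?z * (?\<psi> \<circ> chart_inv c) x"
        using partial_mult[OF D[OF \<phi>] D[OF \<phi>], of j] partial_mult[OF D[OF \<zeta>(1)] D[OF \<psi>], of j]
        by simp
      then have "\<zeta> p * ?y = 2 * \<phi> p * ?a - ?z * (\<phi> p * \<phi> p / \<zeta> p)"
        by (simp add: x(2))
      then have "?y = (2 * \<phi> p * ?a - ?z * (\<phi> p * \<phi> p / \<zeta> p)) / \<zeta> p"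
        using \<zeta>(2)[of p] by (simp add: eq_divide_eq mult.commute)
      then show ?thesis
        using \<zeta>(2)[of p] by (simp add: t_def power2_eq_square diff_divide_distrib)
    qed
    then show ?thesis by (simp add: differential_def vec_eq_iff)
  qed
  let ?X = "grad_chart g c \<phi> x" and ?Y = "grad_chart g c \<zeta> x"
  have inner: "differential c h x \<bullet> grad_chart g c k x = grad_chart g c h x \<bullet> (g c x *v grad_chart g c k x)"
    for h k using grad_inner_chart_eq_metric[OF c(1) x(1)] by (simp add: grad_inner_chart_def)
  have "0 \<le> (?X - t *\<^sub>R ?Y) \<bullet> (g c x *v (?X - t *\<^sub>R ?Y))"
    by (rule metric_nonneg[OF c(1) x(1)])
  also have "\<dots> = ?X \<bullet> (g c x *v ?X) - 2 * t * (?X \<bullet> (g c x *v ?Y)) + t\<^sup>2 * (?Y \<bullet> (g c x *v ?Y))"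
    using metric_sym[OF c(1) x(1), of ?Y ?X]
    by (simp add: matrix_vector_mult_diff_distrib matrix_vector_mult_scaleR inner_diff_left
        inner_diff_right power2_eq_square algebra_simps)
  finally have "differential c ?\<psi> x \<bullet> ?Y \<le> differential c \<phi> x \<bullet> ?X"
    unfolding diff by (simp add: inner_diff_left inner)
  then show ?thesis
    by (simp add: grad_inner_def grad_inner_chart_def c_def[symmetric] x_def[symmetric])
qed

end

section \<open>The stability inequality\<close>

text \<open>
The quotients \<open>b i j = a i j * \<zeta> j / \<zeta> i\<close> are positive and satisfy \<open>b i j * b j i = a i j * a j i\<close>, so
the inequality is the sum over all pairs of the arithmetic-geometric mean inequality for
\<open>b i j * (\<phi> i)\<^sup>2\<close> and \<open>b j i * (\<phi> j)\<^sup>2\<close>.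
\<close>

lemma stability_pointwise:
  fixes a :: "'m::finite \<Rightarrow> 'm \<Rightarrow> real" and \<zeta> \<phi> :: "'m \<Rightarrow> real"
  assumes a: "\<And>i j. 0 < a i j * \<zeta> i * \<zeta> j"
  shows "(\<Sum>i\<in>UNIV. \<Sum>j\<in>UNIV. sqrt (a i j * a j i) * \<phi> i * \<phi> j)
    \<le> (\<Sum>i\<in>UNIV. (\<Sum>j\<in>UNIV. a i j * \<zeta> j) * (\<phi> i * \<phi> i / \<zeta> i))"
proof -
  have nz: "\<zeta> i \<noteq> 0" for i using a[of i i] by auto
  define b where "b i j = a i j * \<zeta> j / \<zeta> i" for i j
  have b: "0 < b i j" for i j
  proof -
    have "b i j = a i j * \<zeta> i * \<zeta> j / (\<zeta> i * \<zeta> i)"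
      using nz by (simp add: b_def field_simps)
    also have "0 < \<dots>"
      using nz[of i] by (intro divide_pos_pos a) (auto simp: zero_less_mult_iff)
    finally show ?thesis .
  qed
  have ab: "a i j * a j i = b i j * b j i" for i j
    using nz by (simp add: b_def field_simps)
  have amgm: "2 * (sqrt (a i j * a j i) * \<phi> i * \<phi> j) \<le> b i j * (\<phi> i)\<^sup>2 + b j i * (\<phi> j)\<^sup>2" for i j
  proof -
    have "0 \<le> (sqrt (b i j) * \<phi> i - sqrt (b j i) * \<phi> j)\<^sup>2" by simp
    also have "\<dots> = b i j * (\<phi> i)\<^sup>2 + b j i * (\<phi> j)\<^sup>2 - 2 * (sqrt (b i j) * sqrt (b j i) * \<phi> i * \<phi> j)"
      using b[of i j] b[of j i] by (simp add: power2_diff power_mult_distrib)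
    finally show ?thesis by (simp add: ab real_sqrt_mult)
  qed
  have "2 * (\<Sum>i\<in>UNIV. \<Sum>j\<in>UNIV. sqrt (a i j * a j i) * \<phi> i * \<phi> j) =
      (\<Sum>i\<in>UNIV. \<Sum>j\<in>UNIV. 2 * (sqrt (a i j * a j i) * \<phi> i * \<phi> j))"
    by (simp add: sum_distrib_left)
  also have "\<dots> \<le> (\<Sum>i\<in>UNIV. \<Sum>j\<in>UNIV. b i j * (\<phi> i)\<^sup>2 + b j i * (\<phi> j)\<^sup>2)"
    by (intro sum_mono amgm)
  also have "\<dots> = (\<Sum>i\<in>UNIV. \<Sum>j\<in>UNIV. b i j * (\<phi> i)\<^sup>2) + (\<Sum>i\<in>UNIV. \<Sum>j\<in>UNIV. b j i * (\<phi> j)\<^sup>2)"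
    by (simp add: sum.distrib)
  also have "(\<Sum>i\<in>UNIV. \<Sum>j\<in>UNIV. b j i * (\<phi> j)\<^sup>2) = (\<Sum>i\<in>UNIV. \<Sum>j\<in>UNIV. b i j * (\<phi> i)\<^sup>2)"
    by (rule sum.swap)
  also have "(\<Sum>i\<in>UNIV. \<Sum>j\<in>UNIV. b i j * (\<phi> i)\<^sup>2) =
      (\<Sum>i\<in>UNIV. (\<Sum>j\<in>UNIV. a i j * \<zeta> j) * (\<phi> i * \<phi> i / \<zeta> i))"
    by (simp add: b_def sum_distrib_left sum_divide_distrib power2_eq_square mult_ac)
  finally show ?thesis by simp
qed

theorem lemma2p1:
  fixes A :: "('a::{t2_space, second_countable_topology}, 'n::finite) chart set"
    and g :: "('a, 'n) metric_field"
    and H :: "'m::finite \<Rightarrow> real ^ 'm \<Rightarrow> real"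
    and u \<phi> :: "'m \<Rightarrow> 'a \<Rightarrow> real"
  assumes "smooth_atlas A"
    and "riemannian_metric A g"
    and "connected (UNIV :: 'a set)"
    and "complete_riemannian A g"
    and "\<And>i. Ck_on 1 UNIV (H i)"
    and "\<And>i j p. dH H u i j p * dH H u j i p > 0"
    and "stable_solution A g H u"
    and "\<And>i. Ckc_manifold A 1 (\<phi> i)"
  shows "(\<Sum>i\<in>UNIV. \<Sum>j\<in>UNIV.
            LINT p|riemannian_volume A g. sqrt (dH H u j i p * dH H u i j p) * \<phi> i p * \<phi> j p)
         \<le> (\<Sum>i\<in>UNIV. LINT p|riemannian_volume A g. (grad_norm A g (\<phi> i) p)\<^sup>2)"
proof -
  interpret riemannian_manifold A g by (unfold_locales) (fact assms(1,2))+
  obtain \<zeta> :: "'m \<Rightarrow> 'a \<Rightarrow> real" and lam :: real where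
    \<zeta>3: "\<And>i. Ck_manifold A 3 (\<zeta> i)" and lam: "0 \<le> lam"
    and eq: "\<And>i p. - laplace_beltrami A g (\<zeta> i) p = (\<Sum>j\<in>UNIV. dH H u j i p * \<zeta> j p) + lam * \<zeta> i p"
    and pos: "\<And>i j p. 0 < dH H u j i p * \<zeta> i p * \<zeta> j p"
    using assms(7) unfolding stable_solution_def by blast
  have C2I: "C2 f" if "Ck_manifold A 3 f" for f
    using that Ck_on_SucD unfolding C2_def Ck_manifold_def numeral_3_eq_3 by blast
  have \<zeta>2: "C2 (\<zeta> i)" for i by (rule C2I[OF \<zeta>3])
  have \<zeta>1: "C1 (\<zeta> i)" for i by (rule C2_imp_C1[OF \<zeta>2])
  have \<zeta>0: "\<zeta> i p \<noteq> 0" for i p using pos[of i i p] by auto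
  have u1: "C1 (u i)" for i
    using assms(7) unfolding stable_solution_def is_solution_def by (intro C2_imp_C1 C2I) blast
  have \<phi>1: "C1 (\<phi> i)" for i using assms(8) by (simp add: Ckc_manifold_def C1_def)
  define K where "K i = closure {p. \<phi> i p \<noteq> 0}" for i
  have K: "compact (K i)" for i using assms(8) by (simp add: Ckc_manifold_def K_def)
  have \<phi>K: "\<phi> i p = 0" if "p \<notin> K i" for i p
    using that closure_subset[of "{p. \<phi> i p \<noteq> 0}"] by (auto simp: K_def)
  note cont_\<phi> = C1_continuous[OF \<phi>1]
  have cont_dH: "continuous_on UNIV (dH H u j i)" for i j
  proof -
    have u: "continuous_on UNIV (\<lambda>p. \<chi> k. u k p)"
      by (intro continuous_on_vec_lambda C1_continuous[OF u1])
    have H: "continuous_on UNIV (partial j (H i))"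
      using assms(5) by (intro continuous_on_partial) (simp only: C1_on_def)
    show ?thesis
      unfolding dH_def[abs_def] by (rule continuous_on_compose2[OF H u]) simp
  qed
  define \<psi> where "\<psi> i p = \<phi> i p * \<phi> i p / \<zeta> i p" for i p
  have \<psi>1: "C1 (\<psi> i)" for i
    unfolding \<psi>_def by (rule C1_divide[OF C1_mult[OF \<phi>1 \<phi>1] \<zeta>1 closed_UNIV]) (simp_all add: \<zeta>0)
  have \<psi>K: "\<psi> i p = 0" if "p \<notin> K i" for i p by (simp add: \<psi>_def \<phi>K[OF that])
  let ?Q = "\<lambda>i j p. sqrt (dH H u j i p * dH H u i j p) * \<phi> i p * \<phi> j p"
  let ?R = "\<lambda>i p. - laplace_beltrami A g (\<zeta> i) p * \<psi> i p"
  let ?G = "\<lambda>i p. grad_inner (\<psi> i) (\<zeta> i) p" and ?N = "\<lambda>i p. grad_inner (\<phi> i) (\<phi> i) p"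
  have int_Q: "integrable dV (?Q i j)" for i j
    by (rule integrable_volume[OF _ K[of i]]) (intro continuous_intros cont_dH cont_\<phi>, simp add: \<phi>K)
  have int_R: "integrable dV (?R i)" for i
    by (rule integrable_volume[OF _ K[of i]])
      (intro continuous_intros continuous_laplace_beltrami[OF \<zeta>2] C1_continuous[OF \<psi>1], simp add: \<psi>K)
  have int_G: "integrable dV (?G i)" for i
    by (rule integrable_volume[OF continuous_grad_inner[OF \<psi>1 \<zeta>1] K[of i]])
      (rule grad_inner_eq_0[OF compact_imp_closed[OF K] \<psi>K])
  have int_N: "integrable dV (?N i)" for i
    by (rule integrable_volume[OF continuous_grad_inner[OF \<phi>1 \<phi>1] K[of i]])
      (rule grad_inner_eq_0[OF compact_imp_closed[OF K] \<phi>K])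
  have "(\<Sum>i\<in>UNIV. \<Sum>j\<in>UNIV. LINT p|dV. ?Q i j p) = (LINT p|dV. (\<Sum>i\<in>UNIV. \<Sum>j\<in>UNIV. ?Q i j p))"
    using int_Q by (simp add: Bochner_Integration.integral_sum)
  also have "\<dots> \<le> (LINT p|dV. (\<Sum>i\<in>UNIV. ?R i p))"
  proof (rule integral_mono)
    show "integrable dV (\<lambda>p. \<Sum>i\<in>UNIV. \<Sum>j\<in>UNIV. ?Q i j p)" "integrable dV (\<lambda>p. \<Sum>i\<in>UNIV. ?R i p)"
      by (intro Bochner_Integration.integrable_sum int_Q int_R)+
    fix p
    have "(\<Sum>i\<in>UNIV. \<Sum>j\<in>UNIV. ?Q i j p) \<le>
        (\<Sum>i\<in>UNIV. (\<Sum>j\<in>UNIV. dH H u j i p * \<zeta> j p) * \<psi> i p)"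
      unfolding \<psi>_def
      by (rule stability_pointwise[where a = "\<lambda>i j. dH H u j i p" and \<zeta> = "\<lambda>i. \<zeta> i p" and \<phi> = "\<lambda>i. \<phi> i p", OF pos])
    also have "\<dots> \<le> (\<Sum>i\<in>UNIV. ?R i p)"
    proof (rule sum_mono)
      fix i
      have "lam * \<zeta> i p * \<psi> i p = lam * (\<phi> i p)\<^sup>2"
        using \<zeta>0[of i p] by (simp add: \<psi>_def power2_eq_square)
      moreover have "0 \<le> lam * (\<phi> i p)\<^sup>2" using lam by simp
      ultimately have "0 \<le> lam * \<zeta> i p * \<psi> i p" by (simp only:)
      then show "(\<Sum>j\<in>UNIV. dH H u j i p * \<zeta> j p) * \<psi> i p \<le> ?R i p"
        unfolding eq by (simp add: distrib_right)
    qed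
    finally show "(\<Sum>i\<in>UNIV. \<Sum>j\<in>UNIV. ?Q i j p) \<le> (\<Sum>i\<in>UNIV. ?R i p)" .
  qed
  also have "\<dots> = (\<Sum>i\<in>UNIV. LINT p|dV. ?R i p)"
    by (rule Bochner_Integration.integral_sum[OF int_R])
  also have "\<dots> \<le> (\<Sum>i\<in>UNIV. LINT p|dV. ?N i p)"
  proof (rule sum_mono)
    fix i
    have "(LINT p|dV. ?G i p) - (LINT p|dV. ?R i p) = (LINT p|dV. ?G i p - ?R i p)"
      by (rule Bochner_Integration.integral_diff[OF int_G int_R, symmetric])
    also have "\<dots> = (LINT p|dV. laplace_beltrami A g (\<zeta> i) p * \<psi> i p + ?G i p)"
      by (simp add: add.commute)
    also have "\<dots> = 0" by (rule green[OF \<zeta>2 \<psi>1 K \<psi>K])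
    finally have "(LINT p|dV. ?R i p) = (LINT p|dV. ?G i p)" by simp
    also have "\<dots> \<le> (LINT p|dV. ?N i p)"
      unfolding \<psi>_def
      by (rule integral_mono[OF int_G[unfolded \<psi>_def] int_N picone_inequality[OF \<phi>1 \<zeta>1 \<zeta>0]])
    finally show "(LINT p|dV. ?R i p) \<le> (LINT p|dV. ?N i p)" .
  qed
  finally show ?thesis by (simp only: grad_norm_square)
qed

end
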